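(* Let $n,d,h\ge1$ and $\lambda\vdash h$. Any right symmetrized bitableau $(U|\boxed{V})\in\mathbb C_h[M_{n,d}]$, with $U$ a tableau on $\{1,\dots,n\}$ and $V$ a tableau on $\{1,\dots,d\}$ of shape $sh(U)=sh(V)=\lambda$, can be written as a linear combination (with complex coefficients) of immanants $imm_\lambda(i_1i_2\cdots i_h;j_1j_2\cdots j_h)$, $(i_1,\dots,i_h)\in\{1,\dots,n\}^h$, $(j_1,\dots,j_h)\in\{1,\dots,d\}^h$, associated to the same shape $\lambda$.
   Context: $\mathbb C[M_{n,d}]$ is the polynomial algebra in commuting variables $(i|j)$, $1\le i\le n$, $1\le j\le d$; $\mathbb C_h[M_{n,d}]$ is its homogeneous component of degree $h$. For words of equal length $p$, $(i_1\cdots i_p|j_1\cdots j_p)=(-1)^{\binom p2}\det\big((i_r|j_s)\big)_{r,s=1,\dots,p}$. A Young tableau of shape $\lambda\vdash h$ over an alphabet is an arbitrary filling of the diagram of $\lambda$; $sh(\cdot)$ denotes the shape. For tableaux $S$ on $\{1,\dots,n\}$ and $T$ on $\{1,\dots,d\}$ of the same shape with row words $\omega_1,\dots,\omega_p$ and $\varpi_1,\dots,\varpi_p$, the bitableau is $$(S|T)=(-1)^{\sum_{k=2}^p\ell(\omega_k)(\ell(\varpi_1)+\cdots+\ell(\varpi_{k-1}))}(\omega_1|\varpi_1)\cdots(\omega_p|\varpi_p),$$ $\ell$ denoting word length. In particular a column bitableau (shape $(1^h)$) is $$\left(\begin{array}{c}i_1\\ \vdots\\ i_h\end{array}\right|\left.\begin{array}{c}j_1\\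 \vdots\\ j_h\end{array}\right)=(-1)^{\binom h2}(i_1|j_1)\cdots(i_h|j_h).$$ The right symmetrized bitableau is $(S|\boxed{T})=\sum_{\overline T}(S|\overline T)$, the sum over all tableaux $\overline T$ obtained by permuting the cells within each column of $T$ (one summand for each tuple of column permutations, so repeated entries in a column give multiplicities). For $\lambda\vdash h$, $\chi^\lambda$ is the irreducible character of the symmetric group $\mathbf S_h$ labelled so that $\lambda=(1^h)$ gives the trivial and $\lambda=(h)$ the sign character (i.e. the character usually attached to the conjugate partition). The immanant is $$imm_\lambda(i_1\cdots i_h;j_1\cdots j_h)=\sum_{\sigma\in\mathbf S_h}\chi^\lambda(\sigma)\left(\begin{array}{c}i_{\sigma(1)}\\ \vdots\\ i_{\sigma(h)}\end{array}\right|\left.\begin{array}{c}j_1\\ \vdots\\ j_h\end{array}\right).$$ *)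

theory Defs
  imports
    "HOL-Library.Poly_Mapping"
    "HOL-Library.FuncSet"
    "HOL-Library.Function_Algebras"
    "HOL-Combinatorics.Permutations"
    "Jordan_Normal_Form.Determinant"
begin

section \<open>The polynomial algebra\<close>

text \<open>Polynomials in commuting variables indexed by pairs, with complex coefficients: a monomial is
  a finitely supported exponent function, and the product of poly mappings is the convolution
  product.  The algebra of polynomial functions on \<open>n \<times> d\<close> matrices is the subalgebra of those
  polynomials whose variables have indices in \<open>{1..n} \<times> {1..d}\<close>.\<close>

type_synonym letter_poly = "((nat \<times> nat) \<Rightarrow>\<^sub>0 nat) \<Rightarrow>\<^sub>0 complex"

definition letter_var :: "nat \<Rightarrow> nat \<Rightarrow> letter_poly" where
  "letter_var i j = Poly_Mapping.single (Poly_Mapping.single (i, j) 1) 1"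

definition const_poly :: "complex \<Rightarrow> letter_poly" where
  "const_poly c = Poly_Mapping.single 0 c"

definition hom_component :: "nat \<Rightarrow> nat \<Rightarrow> nat \<Rightarrow> letter_poly set" where
  "hom_component n d h = {p. \<forall>m\<in>Poly_Mapping.keys p.
     Poly_Mapping.keys m \<subseteq> {1..n} \<times> {1..d} \<and>
     (\<Sum>x\<in>Poly_Mapping.keys m. Poly_Mapping.lookup m x) = h}"


section \<open>Partitions, tableaux, bitableaux\<close>

definition is_partition :: "nat list \<Rightarrow> nat \<Rightarrow> bool" where
  "is_partition lam h \<longleftrightarrow> sorted_wrt (\<ge>) lam \<and> 0 \<notin> set lam \<and> sum_list lam = h"

fun conj_partition :: "nat list \<Rightarrow> nat list" where
  "conj_partition [] = []"
| "conj_partition (l # ls) = map (\<lambda>c. length (filter (\<lambda>k. c < k) (l # ls))) [0..<l]"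

text \<open>A tableau is the list of its row words; no monotonicity is required of the filling.\<close>

type_synonym tableau = "nat list list"

definition shape :: "tableau \<Rightarrow> nat list" where
  "shape T = map length T"

definition is_tableau :: "nat list \<Rightarrow> nat set \<Rightarrow> tableau \<Rightarrow> bool" where
  "is_tableau lam A T \<longleftrightarrow> shape T = lam \<and> (\<forall>w\<in>set T. set w \<subseteq> A)"

definition words :: "nat set \<Rightarrow> nat \<Rightarrow> nat list set" where
  "words A h = {w. length w = h \<and> set w \<subseteq> A}"

definition biproduct :: "nat list \<Rightarrow> nat list \<Rightarrow> letter_poly" where
  "biproduct u v = (-1) ^ (length u choose 2) *
     det (mat (length u) (length u) (\<lambda>(r, s). letter_var (u ! r) (v ! s)))"

definition bitableau :: "tableau \<Rightarrow> tableau \<Rightarrow> letter_poly" where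
  "bitableau S T =
     (-1) ^ (\<Sum>k\<in>{1..<length S}. length (S ! k) * (\<Sum>m<k. length (T ! m))) *
     (\<Prod>k<length S. biproduct (S ! k) (T ! k))"

definition column :: "nat list \<Rightarrow> tableau" where
  "column w = map (\<lambda>x. [x]) w"

lemma biproduct_single: "biproduct [i] [j] = letter_var i j"
  by (simp add: biproduct_def det_def binomial_eq_0)

lemma bitableau_column:
  assumes "length u = length v"
  shows "bitableau (column u) (column v) =
           (-1) ^ (length u choose 2) * (\<Prod>k<length u. letter_var (u ! k) (v ! k))"
proof -
  have "(\<Sum>k\<in>{1..<length u}. length (column u ! k) * (\<Sum>m<k. length (column v ! m)))
          = (\<Sum>k\<in>{1..<length u}. k)"
    using assms by (intro sum.cong) (auto simp: column_def)
  also have "\<dots> = (\<Sum>k<length u. k)"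
    by (intro sum.mono_neutral_left) auto
  also have "\<dots> = length u choose 2"
    by (simp add: choose_two Sum_Ico_nat lessThan_atLeast0)
  finally show ?thesis
    using assms by (simp add: bitableau_def biproduct_single column_def)
qed

text \<open>One permutation of the (0-based) row indices for each column.\<close>

definition column_perm_tuples :: "nat list \<Rightarrow> (nat \<Rightarrow> nat \<Rightarrow> nat) set" where
  "column_perm_tuples lam =
     (\<Pi>\<^sub>E c\<in>{..<length (conj_partition lam)}. {p. p permutes {..<conj_partition lam ! c}})"

definition permute_columns :: "(nat \<Rightarrow> nat \<Rightarrow> nat) \<Rightarrow> tableau \<Rightarrow> tableau" where
  "permute_columns q T =
     map (\<lambda>r. map (\<lambda>c. T ! (q c r) ! c) [0..<length (T ! r)]) [0..<length T]"

text \<open>The sum ranges over tuples of column permutations, not over the set of resulting tableaux,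
  so repeated entries in a column produce multiplicities.\<close>

definition right_symmetrized :: "tableau \<Rightarrow> tableau \<Rightarrow> letter_poly" where
  "right_symmetrized S T = (\<Sum>q\<in>column_perm_tuples (shape T). bitableau S (permute_columns q T))"


section \<open>Irreducible characters of the symmetric group\<close>

text \<open>Elements of the group algebra of the symmetric group on \<open>{..<h}\<close> are complex functions on
  \<open>nat \<Rightarrow> nat\<close> that vanish outside the permutations of \<open>{..<h}\<close>.\<close>

definition cscale :: "complex \<Rightarrow> ('a \<Rightarrow> complex) \<Rightarrow> ('a \<Rightarrow> complex)" where
  "cscale a f = (\<lambda>x. a * f x)"

interpretation cfun: vector_space cscale
  by unfold_locales (auto simp: cscale_def fun_eq_iff algebra_simps)

definition group_algebra :: "nat \<Rightarrow> ((nat \<Rightarrow> nat) \<Rightarrow> complex) set" where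
  "group_algebra h = {f. \<forall>t. \<not> t permutes {..<h} \<longrightarrow> f t = 0}"

definition convolution :: "nat \<Rightarrow> ((nat \<Rightarrow> nat) \<Rightarrow> complex) \<Rightarrow> ((nat \<Rightarrow> nat) \<Rightarrow> complex) \<Rightarrow> (nat \<Rightarrow> nat) \<Rightarrow> complex"
  where "convolution h f g = (\<lambda>t. \<Sum>s | s permutes {..<h}. f s * g (inv_into UNIV s \<circ> t))"

definition group_elem :: "(nat \<Rightarrow> nat) \<Rightarrow> (nat \<Rightarrow> nat) \<Rightarrow> complex" where
  "group_elem s = (\<lambda>t. if t = s then 1 else 0)"

text \<open>The boxes of the diagram of \<open>mu\<close> are numbered \<open>0, 1, 2, \<dots>\<close> along the rows.\<close>

definition box_no :: "nat list \<Rightarrow> nat \<Rightarrow> nat \<Rightarrow> nat" where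
  "box_no mu r c = sum_list (take r mu) + c"

definition row_group :: "nat list \<Rightarrow> (nat \<Rightarrow> nat) set" where
  "row_group mu = {s. s permutes {..<sum_list mu} \<and>
     (\<forall>r<length mu. s ` {box_no mu r c | c. c < mu ! r} = {box_no mu r c | c. c < mu ! r})}"

definition column_group :: "nat list \<Rightarrow> (nat \<Rightarrow> nat) set" where
  "column_group mu = {s. s permutes {..<sum_list mu} \<and>
     (\<forall>c. s ` {box_no mu r c | r. r < length mu \<and> c < mu ! r} =
               {box_no mu r c | r. r < length mu \<and> c < mu ! r})}"

definition young_symmetrizer :: "nat list \<Rightarrow> (nat \<Rightarrow> nat) \<Rightarrow> complex" where
  "young_symmetrizer mu = convolution (sum_list mu)
     (\<Sum>p\<in>row_group mu. group_elem p)
     (\<Sum>q\<in>column_group mu. cscale (of_int (sign q)) (group_elem q))"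

text \<open>The Specht module, as the left ideal generated by the Young symmetrizer; with this convention
  \<open>[h]\<close> gives the trivial and \<open>replicate h 1\<close> the sign representation.\<close>

definition specht_module :: "nat list \<Rightarrow> ((nat \<Rightarrow> nat) \<Rightarrow> complex) set" where
  "specht_module mu =
     (\<lambda>f. convolution (sum_list mu) f (young_symmetrizer mu)) ` group_algebra (sum_list mu)"

text \<open>The trace on a finite-dimensional subspace \<open>V\<close>, computed in an arbitrary basis of \<open>V\<close>.\<close>

definition trace_on :: "('a \<Rightarrow> complex) set \<Rightarrow> (('a \<Rightarrow> complex) \<Rightarrow> ('a \<Rightarrow> complex)) \<Rightarrow> complex" where
  "trace_on V f = (let B = (SOME B. cfun.independent B \<and> cfun.span B = V)
     in \<Sum>b\<in>B. cfun.representation B (f b) b)"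

definition specht_character :: "nat list \<Rightarrow> (nat \<Rightarrow> nat) \<Rightarrow> complex" where
  "specht_character mu s =
     trace_on (specht_module mu) (\<lambda>v. convolution (sum_list mu) (group_elem s) v)"

text \<open>Labelling by the conjugate partition: \<open>replicate h 1\<close> gives the trivial character and
  \<open>[h]\<close> the sign character.\<close>

definition chi :: "nat list \<Rightarrow> (nat \<Rightarrow> nat) \<Rightarrow> complex" where
  "chi lam = specht_character (conj_partition lam)"


section \<open>Immanants\<close>

text \<open>\<open>permute_list s [i\<^sub>0, i\<^sub>1, \<dots>] = [i (s 0), i (s 1), \<dots>]\<close>; positions in words are 0-based.\<close>

definition imm :: "nat list \<Rightarrow> nat list \<Rightarrow> nat list \<Rightarrow> letter_poly" where
  "imm lam u v = (\<Sum>s | s permutes {..<length u}.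
     const_poly (chi lam s) * bitableau (column (permute_list s u)) (column v))"

end

theory Submission
  imports Defs
begin

text \<open>Let \<open>\<mu>\<close> be conjugate to \<open>\<lambda>\<close>, so that rows of \<open>\<lambda>\<close> are columns of \<open>\<mu>\<close>. Expanding the
  determinants, \<open>(U|V)\<close> symmetrized along the columns is, up to sign,
  \<open>\<Sum>g. c g * \<Prod>x. (u x|v (g x))\<close>, where \<open>c\<close> is the Young symmetrizer of \<open>\<mu>\<close> and \<open>u\<close>, \<open>v\<close> are the
  fillings. Since \<open>c\<^sup>2 = a c\<close> with \<open>a \<noteq> 0\<close>, the character of the left ideal generated by \<open>c\<close> is
  \<open>\<chi> s = (\<Sum>g. c (g\<inverse> s\<inverse> g)) / a\<close>. By von Neumann's lemma \<open>c x c\<close> is a multiple of \<open>c\<close> for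
  every \<open>x\<close>, and evaluating these multiples shows that \<open>z = (\<Sum>s. \<chi> (s\<inverse>) s)\<close> satisfies
  \<open>z c = a c\<close>. Hence \<open>c\<close> is a combination of the elements \<open>z g\<close>, and \<open>z g\<close> corresponds to
  the immanant of \<open>u \<circ> g\<inverse>\<close> and \<open>v\<close>.\<close>

section \<open>The group algebra of the symmetric group\<close>

text \<open>Conceptually \<open>z\<close> is \<open>h!\<close> divided by the dimension of the
  Specht module, times the central idempotent of the isotypic component containing \<open>c\<close>;
  that quotient is \<open>a\<close>. The part of Schur's lemma is played by the scalars in
  \<open>c x c\<close>, each of which can be read off at the identity, where \<open>c\<close> has
  coefficient 1. That \<open>a\<close> is nonzero comes from positivity of the form given by the
  adjoint. The character is a trace in an unspecified basis of the left ideal, so no basis is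
  written down: right multiplication by \<open>c / a\<close> projects the group algebra onto the
  ideal, and this moves the computation to the basis of group elements. Inverses have to match at
  both ends. The trace formula evaluates \<open>c\<close> at conjugates of the inverse of
  \<open>s\<close>. An immanant permutes the first word while \<open>c\<close> acts on the second,
  and moving a permutation across also inverts it. In the expansion of the symmetrized bitableau the
  determinants contribute the right factor of a product of permutations and the column
  symmetrization the left one, which is the order of the two factors of \<open>c\<close>.\<close>

lemma sum_fun_apply: "(\<Sum>i\<in>I. f i) x = (\<Sum>i\<in>I. f i x)"
  for f :: "'i \<Rightarrow> 'a \<Rightarrow> 'b::comm_monoid_add"
  by (induction I rule: infinite_finite_induct) auto

text \<open>The notation \<open>inv\<close> is taken by the group inverse of HOL-Algebra.\<close>

abbreviation perm_inv :: "('a \<Rightarrow> 'b) \<Rightarrow> 'b \<Rightarrow> 'a" where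
  "perm_inv s \<equiv> inv_into UNIV s"

locale sym_algebra =
  fixes h :: nat
begin

abbreviation G :: "(nat \<Rightarrow> nat) set" where
  "G \<equiv> {s. s permutes {..<h}}"

abbreviation conv (infixl "\<star>" 70) where
  "f \<star> g \<equiv> convolution h f g"

abbreviation delta ("\<delta>") where
  "\<delta> \<equiv> group_elem"

lemma finite_G: "finite G"
  by (simp add: finite_permutations)

lemma G_inv: "s \<in> G \<Longrightarrow> perm_inv s \<in> G"
  by (simp add: permutes_inv)

lemma G_comp: "s \<in> G \<Longrightarrow> t \<in> G \<Longrightarrow> s \<circ> t \<in> G"
  by (simp add: permutes_compose)

lemma G_id: "id \<in> G"
  by (simp add: permutes_id)

lemma inv_cancel:
  assumes "s \<in> G"
  shows "perm_inv s \<circ> (s \<circ> t) = t" "s \<circ> (perm_inv s \<circ> t) = t"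
    "t \<circ> s \<circ> perm_inv s = t" "t \<circ> perm_inv s \<circ> s = t"
    "perm_inv s \<circ> s = id" "s \<circ> perm_inv s = id" "perm_inv (perm_inv s) = s"
  using assms
  by (auto simp: permutes_inverses permutes_inv_inv fun_eq_iff)

lemma inv_comp: "s \<in> G \<Longrightarrow> t \<in> G \<Longrightarrow> perm_inv (s \<circ> t) = perm_inv t \<circ> perm_inv s"
  by (simp add: o_inv_distrib permutes_bij)

lemma comp_in_G_iff: "s \<in> G \<Longrightarrow> s \<circ> t \<in> G \<longleftrightarrow> t \<in> G"
  by (metis G_comp G_inv inv_cancel(1))

lemma sum_left: "s \<in> G \<Longrightarrow> (\<Sum>t\<in>G. f (s \<circ> t)) = (\<Sum>t\<in>G. f t)"
  using setum_permutations_compose_left[of s "{..<h}" f] by simp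

lemma sum_right: "s \<in> G \<Longrightarrow> (\<Sum>t\<in>G. f (t \<circ> s)) = (\<Sum>t\<in>G. f t)"
  using sum_permutations_compose_right[of s "{..<h}" f] by simp

lemma sum_inverse: "(\<Sum>t\<in>G. f (perm_inv t)) = (\<Sum>t\<in>G. f t)"
  using sum_permutations_inverse[of f "{..<h}"] by simp

lemma conv_apply: "(f \<star> g) t = (\<Sum>s\<in>G. f s * g (perm_inv s \<circ> t))"
  by (simp add: convolution_def)

lemma conv_assoc: "(f \<star> g) \<star> k = f \<star> (g \<star> k)"
proof
  fix t
  have "((f \<star> g) \<star> k) t = (\<Sum>s\<in>G. \<Sum>r\<in>G. f r * g (perm_inv r \<circ> s) * k (perm_inv s \<circ> t))"
    by (simp add: conv_apply sum_distrib_right)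
  also have "\<dots> = (\<Sum>r\<in>G. \<Sum>s\<in>G. f r * g (perm_inv r \<circ> s) * k (perm_inv s \<circ> t))"
    by (rule sum.swap)
  also have "\<dots> = (\<Sum>r\<in>G. f r * (\<Sum>s\<in>G. g s * k (perm_inv s \<circ> (perm_inv r \<circ> t))))"
  proof (rule sum.cong[OF refl])
    fix r assume r: "r \<in> G"
    have "(\<Sum>s\<in>G. f r * g (perm_inv r \<circ> s) * k (perm_inv s \<circ> t))
        = (\<Sum>s\<in>G. f r * g (perm_inv r \<circ> (r \<circ> s)) * k (perm_inv (r \<circ> s) \<circ> t))"
      by (rule sum_left[OF r, symmetric])
    also have "\<dots> = (\<Sum>s\<in>G. f r * (g s * k (perm_inv s \<circ> (perm_inv r \<circ> t))))"
      by (intro sum.cong refl) (simp only: inv_cancel[OF r] inv_comp[OF r] o_assoc id_o mult.assoc)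
    finally show "(\<Sum>s\<in>G. f r * g (perm_inv r \<circ> s) * k (perm_inv s \<circ> t))
        = f r * (\<Sum>s\<in>G. g s * k (perm_inv s \<circ> (perm_inv r \<circ> t)))"
      by (simp add: sum_distrib_left)
  qed
  also have "\<dots> = (f \<star> (g \<star> k)) t"
    by (simp add: conv_apply)
  finally show "((f \<star> g) \<star> k) t = (f \<star> (g \<star> k)) t" .
qed

lemma conv_cscale_left: "cscale a f \<star> g = cscale a (f \<star> g)"
  by (simp add: fun_eq_iff conv_apply cscale_def sum_distrib_left mult.assoc)

lemma conv_cscale_right: "f \<star> cscale a g = cscale a (f \<star> g)"
  by (simp add: fun_eq_iff conv_apply cscale_def sum_distrib_left mult.left_commute)

lemma conv_add_left: "(f + g) \<star> k = f \<star> k + g \<star> k"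
  by (simp add: fun_eq_iff conv_apply distrib_right sum.distrib)

lemma delta_conv:
  assumes "s \<in> G"
  shows "(\<delta> s \<star> f) t = f (perm_inv s \<circ> t)"
proof -
  have "(\<delta> s \<star> f) t = (\<Sum>r\<in>G. if r = s then f (perm_inv r \<circ> t) else 0)"
    by (auto simp: conv_apply group_elem_def intro!: sum.cong)
  then show ?thesis
    using assms finite_G by simp
qed

lemma conv_delta:
  assumes "s \<in> G" "f \<in> group_algebra h"
  shows "(f \<star> \<delta> s) t = f (t \<circ> perm_inv s)"
proof -
  have *: "perm_inv r \<circ> t = s \<longleftrightarrow> r = t \<circ> perm_inv s" if "r \<in> G" for r
  proof
    assume "perm_inv r \<circ> t = s"
    with that have "t = r \<circ> s" by (metis inv_cancel(2))
    then show "r = t \<circ> perm_inv s" using assms(1) by (simp only: inv_cancel)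
  next
    assume "r = t \<circ> perm_inv s"
    then have "t = r \<circ> s" using assms(1) by (simp only: inv_cancel)
    then show "perm_inv r \<circ> t = s" using that by (simp only: inv_cancel)
  qed
  have "(f \<star> \<delta> s) t = (\<Sum>r\<in>G. if r = t \<circ> perm_inv s then f r else 0)"
    unfolding conv_apply group_elem_def
    by (intro sum.cong refl) (auto simp only: * mult_1_right mult_zero_right split: if_split)
  also have "\<dots> = (if t \<circ> perm_inv s \<in> G then f (t \<circ> perm_inv s) else 0)"
    using finite_G by simp
  \<comment> \<open>Off the group the right-hand side is 0 as well; here membership of
    \<open>f\<close> in the group algebra enters.\<close>
  also have "\<dots> = f (t \<circ> perm_inv s)"
    using assms(2) by (auto simp: group_algebra_def)
  finally show ?thesis .
qed

lemma delta_conv_delta: "s \<in> G \<Longrightarrow> t \<in> G \<Longrightarrow> \<delta> s \<star> \<delta> t = \<delta> (s \<circ> t)"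
  by (rule ext, subst delta_conv) (auto simp: group_elem_def inv_cancel)

lemma conv_as_sum: "(f \<star> k) t = (\<Sum>g\<in>G. f g * (\<delta> g \<star> k) t)"
  unfolding conv_apply[of f k] by (intro sum.cong refl) (simp only: delta_conv)

text \<open>Linearity in the middle factor: it reduces claims about
  \<open>x \<star> (f \<star> k)\<close> to the case where \<open>f\<close> is a group
  element.\<close>

lemma conv_conv_as_sum: "(x \<star> (f \<star> k)) t = (\<Sum>g\<in>G. f g * (x \<star> (\<delta> g \<star> k)) t)"
proof -
  have "(x \<star> (f \<star> k)) t = (\<Sum>s\<in>G. \<Sum>g\<in>G. x s * (f g * (\<delta> g \<star> k) (perm_inv s \<circ> t)))"
    by (simp only: conv_apply[of x] conv_as_sum[of f] sum_distrib_left)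
  also have "\<dots> = (\<Sum>g\<in>G. \<Sum>s\<in>G. x s * (f g * (\<delta> g \<star> k) (perm_inv s \<circ> t)))"
    by (rule sum.swap)
  also have "\<dots> = (\<Sum>g\<in>G. f g * (x \<star> (\<delta> g \<star> k)) t)"
    by (simp only: conv_apply[of x] sum_distrib_left mult.left_commute)
  finally show ?thesis .
qed

lemma conv_in_algebra:
  assumes "g \<in> group_algebra h"
  shows "f \<star> g \<in> group_algebra h"
proof -
  have "(f \<star> g) t = 0" if "t \<notin> G" for t
    unfolding conv_apply
  proof (rule sum.neutral, rule ballI)
    fix s assume "s \<in> G"
    then have "perm_inv s \<circ> t \<notin> G" using that by (simp only: comp_in_G_iff G_inv not_False_eq_True)
    then show "f s * g (perm_inv s \<circ> t) = 0" using assms by (simp add: group_algebra_def)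
  qed
  then show ?thesis by (simp add: group_algebra_def)
qed

lemma delta_in_algebra: "s \<in> G \<Longrightarrow> \<delta> s \<in> group_algebra h"
  by (auto simp: group_algebra_def group_elem_def)

text \<open>The conjugate-linear involution \<open>f*\<close> that reverses products. The value 0
  off the group keeps it inside the group algebra.\<close>

definition adj :: "((nat \<Rightarrow> nat) \<Rightarrow> complex) \<Rightarrow> (nat \<Rightarrow> nat) \<Rightarrow> complex" where
  "adj f t = (if t \<in> G then cnj (f (perm_inv t)) else 0)"

lemma adj_in_algebra: "adj f \<in> group_algebra h"
  by (simp add: group_algebra_def adj_def)

lemma adj_conv: "adj (f \<star> g) = adj g \<star> adj f"
proof
  fix t
  show "adj (f \<star> g) t = (adj g \<star> adj f) t"
  proof (cases "t \<in> G")
    case False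
    then show ?thesis
      using conv_in_algebra[OF adj_in_algebra, of "adj g" f] by (simp add: adj_def group_algebra_def)
  next
    case True
    have "adj (f \<star> g) t = (\<Sum>s\<in>G. cnj (f s) * cnj (g (perm_inv s \<circ> perm_inv t)))"
      using True by (simp add: adj_def conv_apply)
    also have "\<dots> = (\<Sum>s\<in>G. cnj (f (perm_inv t \<circ> s)) * cnj (g (perm_inv (perm_inv t \<circ> s) \<circ> perm_inv t)))"
      using True G_inv by (intro sum_left[symmetric]) blast
    also have "\<dots> = (\<Sum>s\<in>G. cnj (f (perm_inv t \<circ> s)) * cnj (g (perm_inv s)))"
      using True by (intro sum.cong refl) (simp only: inv_comp G_inv inv_cancel)
    also have "\<dots> = (adj g \<star> adj f) t"
      unfolding conv_apply using True
      by (intro sum.cong refl) (simp only: adj_def G_inv G_comp if_True inv_comp inv_cancel complex_cnj_cnj mult.commute)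
    finally show ?thesis .
  qed
qed

text \<open>Positivity: the coefficient of \<open>f \<star> adj f\<close> at the identity is the sum
  of the squared moduli of the coefficients of \<open>f\<close>.\<close>

lemma self_adjoint_square_zero:
  assumes "f \<in> group_algebra h" "f \<star> adj f = 0"
  shows "f = 0"
proof -
  have "(f \<star> adj f) id = (\<Sum>s\<in>G. f s * cnj (f s))"
    unfolding conv_apply
    by (intro sum.cong refl) (simp add: adj_def permutes_inv permutes_inv_inv)
  also have "\<dots> = complex_of_real (\<Sum>s\<in>G. (cmod (f s))\<^sup>2)"
    by (simp add: complex_norm_square[symmetric])
  finally have "(\<Sum>s\<in>G. (cmod (f s))\<^sup>2) = 0"
    using assms(2) by (metis of_real_eq_0_iff zero_fun_apply)
  then have "\<forall>s\<in>G. f s = 0"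
    using finite_G by (subst (asm) sum_nonneg_eq_0_iff) auto
  then show ?thesis
    using assms(1) by (auto simp: group_algebra_def fun_eq_iff)
qed

end

section \<open>Row and column sums\<close>

text \<open>Treats both groups at once: weight 1 yields the row sum, the sign yields the column sum.
  Weights of square 1 agree on inverse elements, so the weighted sum is self-adjoint.\<close>

locale signed_subgroup = sym_algebra +
  fixes K :: "(nat \<Rightarrow> nat) set" and w :: "(nat \<Rightarrow> nat) \<Rightarrow> complex"
  assumes subset_G: "K \<subseteq> G"
    and id_in: "id \<in> K"
    and comp_in: "p \<in> K \<Longrightarrow> q \<in> K \<Longrightarrow> p \<circ> q \<in> K"
    and inv_in: "p \<in> K \<Longrightarrow> perm_inv p \<in> K"
    and weight_comp: "p \<in> K \<Longrightarrow> q \<in> K \<Longrightarrow> w (p \<circ> q) = w p * w q"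
    and weight_unit: "p \<in> K \<Longrightarrow> w p = 1 \<or> w p = -1"
begin

definition ksum :: "(nat \<Rightarrow> nat) \<Rightarrow> complex" where
  "ksum t = (if t \<in> K then w t else 0)"

lemma in_G: "p \<in> K \<Longrightarrow> p \<in> G"
  using subset_G by blast

lemma weight_square: "p \<in> K \<Longrightarrow> w p * w p = 1"
  using weight_unit[of p] by auto

lemma weight_id: "w id = 1"
  using weight_comp[OF id_in id_in] weight_square[OF id_in] by simp

lemma weight_inv: "p \<in> K \<Longrightarrow> w (perm_inv p) = w p"
  using weight_comp[of p "perm_inv p"] weight_unit[of p] weight_unit[of "perm_inv p"]
    inv_in[of p] inv_cancel(6)[OF in_G, of p] weight_id by auto

lemma comp_in_iff: "p \<in> K \<Longrightarrow> p \<circ> t \<in> K \<longleftrightarrow> t \<in> K"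
  by (metis comp_in in_G inv_cancel(1) inv_in)

lemma comp_in_iff': "p \<in> K \<Longrightarrow> t \<circ> p \<in> K \<longleftrightarrow> t \<in> K"
  by (metis comp_in in_G inv_cancel(3) inv_in)

lemma ksum_in_algebra: "ksum \<in> group_algebra h"
  using subset_G by (auto simp: group_algebra_def ksum_def)

text \<open>Translation by \<open>p\<close> permutes \<open>K\<close> and multiplies every weight by
  \<open>w p\<close>, which is its own inverse.\<close>

lemma delta_ksum: "p \<in> K \<Longrightarrow> \<delta> p \<star> ksum = cscale (w p) ksum"
  by (rule ext)
    (auto simp only: delta_conv in_G ksum_def comp_in_iff inv_in weight_comp weight_inv cscale_def
      mult_zero_right split: if_split)

lemma ksum_delta: "p \<in> K \<Longrightarrow> ksum \<star> \<delta> p = cscale (w p) ksum"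
  by (rule ext)
    (auto simp only: conv_delta in_G ksum_in_algebra ksum_def comp_in_iff' inv_in weight_comp
      weight_inv cscale_def mult_zero_right mult_zero_left mult.commute split: if_split)

lemma ksum_square: "ksum \<star> ksum = cscale (of_nat (card K)) ksum"
proof
  fix t
  have "(ksum \<star> ksum) t = (\<Sum>g\<in>G. ksum g * (\<delta> g \<star> ksum) t)"
    by (rule conv_as_sum)
  also have "\<dots> = (\<Sum>g\<in>K. ksum g * (\<delta> g \<star> ksum) t)"
    using subset_G by (intro sum.mono_neutral_right finite_G) (auto simp: ksum_def)
  also have "\<dots> = (\<Sum>g\<in>K. ksum t)"
    by (intro sum.cong refl)
      (simp add: delta_ksum cscale_def ksum_def weight_square mult.assoc[symmetric] del: mult_eq_0_iff)
  finally show "(ksum \<star> ksum) t = cscale (of_nat (card K)) ksum t"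
    by (simp add: cscale_def)
qed

lemma adj_ksum: "adj ksum = ksum"
proof
  fix t
  have "perm_inv t \<in> K \<longleftrightarrow> t \<in> K" if "t \<in> G"
    using that inv_in inv_cancel(7) by metis
  then show "adj ksum t = ksum t"
    using weight_unit[of t] weight_inv[of t] in_G[of t] by (auto simp: adj_def ksum_def)
qed

end

text \<open>The hypothesis \<open>dichotomy\<close> is von Neumann's lemma on the row and column group of a tableau.\<close>

locale young_pair = sym_algebra h +
  row: signed_subgroup h R "\<lambda>_. 1" + col: signed_subgroup h C w for h R C w +
  assumes dichotomy: "g \<in> G \<Longrightarrow> (\<exists>r\<in>R. \<exists>q\<in>C. g = r \<circ> q) \<or>
      (\<exists>r\<in>R. perm_inv g \<circ> r \<circ> g \<in> C \<and> w (perm_inv g \<circ> r \<circ> g) = -1)"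
    and trivial_inter: "R \<inter> C = {id}"
begin

definition symm :: "(nat \<Rightarrow> nat) \<Rightarrow> complex" where
  "symm = row.ksum \<star> col.ksum"

lemma symm_in_algebra: "symm \<in> group_algebra h"
  unfolding symm_def by (rule conv_in_algebra) (rule col.ksum_in_algebra)

text \<open>A product of a row and a column element is the identity only if the two are inverse to
  each other; both then lie in \<open>R \<inter> C\<close>.\<close>

lemma symm_id: "symm id = 1"
proof -
  have "symm id = (\<Sum>s\<in>G. if s = id then 1 else 0)"
    unfolding symm_def conv_apply
  proof (intro sum.cong refl)
    fix s assume s: "s \<in> G"
    have "perm_inv s \<circ> id \<in> C \<longleftrightarrow> s \<in> C"
      using col.inv_in inv_cancel(7)[OF s] by (metis comp_id)
    then show "row.ksum s * col.ksum (perm_inv s \<circ> id) = (if s = id then 1 else 0)"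
      using trivial_inter row.id_in col.id_in col.weight_id
      by (auto simp: row.ksum_def col.ksum_def)
  qed
  then show ?thesis
    using G_id finite_G by simp
qed

text \<open>If \<open>g = r \<circ> q\<close>, the row sum absorbs \<open>r\<close> and the column
  sum absorbs \<open>q\<close> up to sign. Otherwise \<open>r \<circ> g = g \<circ> q\<close> with
  \<open>w q = -1\<close>: pulling \<open>r\<close> out of the row sum and pushing it through
  \<open>g\<close> into the column sum shows that the product is its own negative, hence 0.\<close>

lemma sandwich_delta:
  assumes g: "g \<in> G"
  shows "\<exists>a. row.ksum \<star> (\<delta> g \<star> col.ksum) = cscale a symm"
  using dichotomy[OF g]
proof
  assume "\<exists>r\<in>R. \<exists>q\<in>C. g = r \<circ> q"
  then obtain r q where rq: "r \<in> R" "q \<in> C" "g = r \<circ> q" by blast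
  then have "\<delta> g = \<delta> r \<star> \<delta> q"
    by (simp only: delta_conv_delta row.in_G col.in_G)
  then have "row.ksum \<star> (\<delta> g \<star> col.ksum) = (row.ksum \<star> \<delta> r) \<star> (\<delta> q \<star> col.ksum)"
    by (simp only: conv_assoc)
  also have "\<dots> = cscale (w q) symm"
    by (simp only: row.ksum_delta rq col.delta_ksum conv_cscale_left conv_cscale_right symm_def
        cfun.scale_one)
  finally show ?thesis by blast
next
  assume "\<exists>r\<in>R. perm_inv g \<circ> r \<circ> g \<in> C \<and> w (perm_inv g \<circ> r \<circ> g) = -1"
  then obtain r where r: "r \<in> R" "perm_inv g \<circ> r \<circ> g \<in> C" "w (perm_inv g \<circ> r \<circ> g) = -1"
    by blast
  let ?q = "perm_inv g \<circ> r \<circ> g"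
  have "g \<circ> ?q = r \<circ> g"
    using g by (simp only: o_assoc[symmetric] inv_cancel)
  then have *: "\<delta> g \<star> \<delta> ?q = \<delta> r \<star> \<delta> g"
    using g r by (simp only: delta_conv_delta row.in_G col.in_G)
  have "row.ksum \<star> (\<delta> g \<star> col.ksum) = (row.ksum \<star> \<delta> r) \<star> (\<delta> g \<star> col.ksum)"
    by (simp only: row.ksum_delta r cfun.scale_one)
  also have "\<dots> = row.ksum \<star> ((\<delta> r \<star> \<delta> g) \<star> col.ksum)"
    by (simp only: conv_assoc)
  also have "\<dots> = row.ksum \<star> (\<delta> g \<star> (\<delta> ?q \<star> col.ksum))"
    by (simp only: *[symmetric] conv_assoc)
  also have "\<dots> = cscale (-1) (row.ksum \<star> (\<delta> g \<star> col.ksum))"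
    by (simp only: col.delta_ksum r conv_cscale_right)
  finally have "row.ksum \<star> (\<delta> g \<star> col.ksum) = cscale 0 symm"
    by (simp add: cscale_def fun_eq_iff)
  then show ?thesis by blast
qed

lemma sandwich: "\<exists>a. row.ksum \<star> (x \<star> col.ksum) = cscale a symm"
proof -
  obtain a where a: "row.ksum \<star> (\<delta> g \<star> col.ksum) = cscale (a g) symm" if "g \<in> G" for g
    using sandwich_delta by metis
  have "(row.ksum \<star> (x \<star> col.ksum)) t = cscale (\<Sum>g\<in>G. x g * a g) symm t" for t
  proof -
    have "(row.ksum \<star> (x \<star> col.ksum)) t = (\<Sum>g\<in>G. x g * (row.ksum \<star> (\<delta> g \<star> col.ksum)) t)"
      by (rule conv_conv_as_sum)
    also have "\<dots> = (\<Sum>g\<in>G. x g * a g * symm t)"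
      by (intro sum.cong refl) (simp only: a cscale_def mult.assoc)
    finally show ?thesis
      by (simp add: cscale_def sum_distrib_right)
  qed
  then show ?thesis by blast
qed

text \<open>The left copy of \<open>symm\<close> supplies the outer row sum for
  \<open>sandwich\<close>, the right copy the outer column sum; everything between them is the
  middle factor.\<close>

lemma symm_conv_symm: "\<exists>a. symm \<star> (x \<star> symm) = cscale a symm"
  using sandwich[of "col.ksum \<star> (x \<star> row.ksum)"] by (simp only: symm_def conv_assoc)

text \<open>The scalar comes from \<open>sandwich\<close>; the point is that it is nonzero. Write
  \<open>r\<close>, \<open>c\<close> for the row and column sums. If \<open>(r c)(r c) = 0\<close>,
  then \<open>b = r c r\<close> is self-adjoint and its square is \<open>card R\<close> times
  \<open>(r c)(r c) r = 0\<close>, so \<open>b = 0\<close> by positivity. Then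
  \<open>(r c)(r c)* = r c c r\<close> is \<open>card C\<close> times \<open>b\<close>, hence 0, so
  \<open>r c = 0\<close> by positivity again, against \<open>symm_id\<close>.\<close>

lemma symm_square: "\<exists>a. a \<noteq> 0 \<and> symm \<star> symm = cscale a symm"
proof -
  have "\<exists>a. symm \<star> symm = cscale a symm"
    using sandwich[of "col.ksum \<star> row.ksum"] by (simp only: symm_def conv_assoc)
  then obtain a where a: "symm \<star> symm = cscale a symm" by blast
  have "a \<noteq> 0"
  proof
    assume "a = 0"
    then have zero: "symm \<star> symm = 0"
      using a by (simp add: cscale_def zero_fun_def)
    define b where "b = symm \<star> row.ksum"
    have adj_symm: "adj symm = col.ksum \<star> row.ksum"
      by (simp only: symm_def adj_conv row.adj_ksum col.adj_ksum)
    then have "adj b = b"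
      by (simp only: b_def adj_conv row.adj_ksum symm_def conv_assoc)
    moreover have "b \<star> b = 0"
    proof -
      have "b \<star> b = symm \<star> ((row.ksum \<star> row.ksum) \<star> (col.ksum \<star> row.ksum))"
        by (simp only: b_def symm_def conv_assoc)
      also have "\<dots> = cscale (of_nat (card R)) ((symm \<star> symm) \<star> row.ksum)"
        by (simp only: row.ksum_square conv_cscale_left conv_cscale_right) (simp only: symm_def conv_assoc)
      also have "\<dots> = 0"
        by (simp add: zero cscale_def fun_eq_iff conv_apply)
      finally show ?thesis .
    qed
    moreover have "b \<in> group_algebra h"
      unfolding b_def by (rule conv_in_algebra) (rule row.ksum_in_algebra)
    ultimately have "b = 0"
      using self_adjoint_square_zero by metis
    have "symm \<star> adj symm = row.ksum \<star> ((col.ksum \<star> col.ksum) \<star> row.ksum)"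
      by (simp only: adj_symm) (simp only: symm_def conv_assoc)
    also have "\<dots> = cscale (of_nat (card C)) b"
      by (simp only: col.ksum_square conv_cscale_left conv_cscale_right b_def symm_def conv_assoc)
    also have "\<dots> = 0"
      by (simp add: \<open>b = 0\<close> cscale_def fun_eq_iff)
    finally have "symm = 0"
      using self_adjoint_square_zero symm_in_algebra by blast
    then show False
      using symm_id by simp
  qed
  with a show ?thesis by blast
qed

text \<open>The scalar \<open>b\<close> with \<open>symm g\<inverse> symm = b symm\<close> is the coefficient of \<open>g\<close> in \<open>symm symm\<close>,
  because \<open>symm\<close> has coefficient 1 at the identity.\<close>

lemma class_sum_conv_symm:
  assumes a: "symm \<star> symm = cscale a symm"
  shows "(\<lambda>s. \<Sum>g\<in>G. symm (perm_inv g \<circ> s \<circ> g)) \<star> symm = cscale (a * a) symm"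
proof
  fix t
  have "((\<lambda>s. \<Sum>g\<in>G. symm (perm_inv g \<circ> s \<circ> g)) \<star> symm) t
      = (\<Sum>g\<in>G. \<Sum>s\<in>G. symm (perm_inv g \<circ> s \<circ> g) * symm (perm_inv s \<circ> t))"
    unfolding conv_apply sum_distrib_right by (rule sum.swap)
  also have "\<dots> = (\<Sum>g\<in>G. a * (symm g * symm (perm_inv g \<circ> t)))"
  proof (intro sum.cong refl)
    fix g assume g: "g \<in> G"
    let ?g' = "perm_inv g"
    have g': "?g' \<in> G" using g by (rule G_inv)
    obtain b where b: "symm \<star> (\<delta> ?g' \<star> symm) = cscale b symm"
      using symm_conv_symm by blast
    have expand: "(symm \<star> (\<delta> ?g' \<star> symm)) u = (\<Sum>s\<in>G. symm s * symm (g \<circ> (perm_inv s \<circ> u)))" for u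
      unfolding conv_apply[of symm] using g g' by (simp only: delta_conv inv_cancel)
    have "b = (symm \<star> (\<delta> ?g' \<star> symm)) id"
      by (simp only: b cscale_def symm_id mult_1_right)
    also have "\<dots> = (\<Sum>s\<in>G. symm s * symm (g \<circ> perm_inv s))"
      by (simp only: expand comp_id)
    also have "\<dots> = (\<Sum>s\<in>G. symm (s \<circ> g) * symm (g \<circ> perm_inv (s \<circ> g)))"
      by (rule sum_right[OF g, symmetric])
    also have "\<dots> = (\<Sum>s\<in>G. symm (s \<circ> g) * symm (perm_inv s))"
      using g by (intro sum.cong refl) (simp only: inv_comp inv_cancel)
    also have "\<dots> = (\<Sum>s\<in>G. symm (perm_inv s \<circ> g) * symm (perm_inv (perm_inv s)))"
      by (rule sum_inverse[symmetric])
    also have "\<dots> = (symm \<star> symm) g"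
      unfolding conv_apply by (intro sum.cong refl) (simp only: inv_cancel mult.commute)
    finally have b_eq: "b = a * symm g"
      by (simp only: a cscale_def)
    \<comment> \<open>Replacing \<open>s\<close> by \<open>g \<circ> s \<circ> ?g'\<close>, in two
      steps, exhibits the inner sum as the coefficient of
      \<open>symm \<star> (\<delta> ?g' \<star> symm)\<close> at
      \<open>?g' \<circ> t\<close>.\<close>
    have "(\<Sum>s\<in>G. symm (?g' \<circ> s \<circ> g) * symm (perm_inv s \<circ> t))
        = (\<Sum>s\<in>G. symm (?g' \<circ> (g \<circ> s) \<circ> g) * symm (perm_inv (g \<circ> s) \<circ> t))"
      by (rule sum_left[OF g, symmetric])
    also have "\<dots> = (\<Sum>s\<in>G. symm (s \<circ> g) * symm (perm_inv s \<circ> (?g' \<circ> t)))"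
      using g by (intro sum.cong refl) (simp only: inv_comp inv_cancel o_assoc[symmetric])
    also have "\<dots> = (\<Sum>s\<in>G. symm (s \<circ> ?g' \<circ> g) * symm (perm_inv (s \<circ> ?g') \<circ> (?g' \<circ> t)))"
      by (rule sum_right[OF g', symmetric])
    also have "\<dots> = (symm \<star> (\<delta> ?g' \<star> symm)) (?g' \<circ> t)"
      unfolding expand using g g'
      by (intro sum.cong refl) (simp only: inv_comp inv_cancel o_assoc[symmetric] comp_id)
    also have "\<dots> = a * (symm g * symm (?g' \<circ> t))"
      by (simp only: b b_eq cscale_def mult.assoc)
    finally show "(\<Sum>s\<in>G. symm (?g' \<circ> s \<circ> g) * symm (perm_inv s \<circ> t))
        = a * (symm g * symm (?g' \<circ> t))" .
  qed
  also have "\<dots> = a * (symm \<star> symm) t"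
    by (simp only: conv_apply sum_distrib_left)
  also have "\<dots> = cscale (a * a) symm t"
    by (simp only: a cscale_def mult.assoc)
  finally show "((\<lambda>s. \<Sum>g\<in>G. symm (perm_inv g \<circ> s \<circ> g)) \<star> symm) t = cscale (a * a) symm t" .
qed

end

section \<open>The character of a left ideal\<close>

context sym_algebra
begin

lemma algebra_eq_sum_delta:
  assumes "f \<in> group_algebra h"
  shows "f = (\<Sum>g\<in>G. cscale (f g) (\<delta> g))"
proof
  fix t
  have "(\<Sum>g\<in>G. cscale (f g) (\<delta> g)) t = (\<Sum>g\<in>G. cscale (f g) (\<delta> g) t)"
    by (simp only: sum_fun_apply)
  also have "\<dots> = (\<Sum>g\<in>G. if g = t then f g else 0)"
    by (intro sum.cong) (auto simp: cscale_def group_elem_def)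
  also have "\<dots> = f t"
    using assms finite_G by (simp add: group_algebra_def)
  finally show "f t = (\<Sum>g\<in>G. cscale (f g) (\<delta> g)) t" by simp
qed

text \<open>Since \<open>c \<star> c = cscale a c\<close>, the map taking \<open>f\<close> to
  \<open>f \<star> c\<close> divided by \<open>a\<close> is a projection of the group algebra onto
  the ideal. The trace of \<open>s\<close> on the ideal is therefore the trace of \<open>s\<close>
  composed with this projection on the whole algebra. In the basis of group elements the diagonal
  entry at \<open>g\<close> is the coefficient of \<open>g\<close> in
  \<open>s g c / a\<close>.\<close>

lemma trace_left_ideal:
  assumes c: "c \<in> group_algebra h" and square: "c \<star> c = cscale a c" and a: "a \<noteq> 0"
    and s: "s \<in> G"
  shows "trace_on ((\<lambda>f. f \<star> c) ` group_algebra h) (\<lambda>v. \<delta> s \<star> v)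
    = (\<Sum>g\<in>G. c (perm_inv g \<circ> perm_inv s \<circ> g)) / a"
proof -
  define V where "V = (\<lambda>f. f \<star> c) ` group_algebra h"
  have V_algebra: "v \<in> group_algebra h" if "v \<in> V" for v
    using that c conv_in_algebra by (auto simp: V_def)
  have V_closed: "\<delta> s \<star> v \<in> V" if "v \<in> V" for v
    using that conv_in_algebra by (auto simp: V_def conv_assoc[symmetric])
  have "cfun.subspace V"
  proof (rule cfun.subspaceI)
    have "0 \<star> c = 0" by (simp add: conv_apply fun_eq_iff)
    moreover have "0 \<in> group_algebra h" by (simp add: group_algebra_def)
    ultimately show "0 \<in> V" unfolding V_def by (metis image_eqI)
  next
    fix x y assume "x \<in> V" "y \<in> V"
    then obtain f g where "x = f \<star> c" "y = g \<star> c" "f \<in> group_algebra h" "g \<in> group_algebra h"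
      by (auto simp: V_def)
    then have "x + y = (f + g) \<star> c" "f + g \<in> group_algebra h"
      by (auto simp: conv_add_left group_algebra_def)
    then show "x + y \<in> V" unfolding V_def by blast
  next
    fix b x assume "x \<in> V"
    then obtain f where "x = f \<star> c" "f \<in> group_algebra h"
      by (auto simp: V_def)
    then have "cscale b x = cscale b f \<star> c"
      by (simp only: conv_cscale_left)
    moreover have "cscale b f \<in> group_algebra h"
      using \<open>f \<in> group_algebra h\<close> by (simp add: group_algebra_def cscale_def)
    ultimately show "cscale b x \<in> V" unfolding V_def by blast
  qed
  define B where "B = (SOME B. cfun.independent B \<and> cfun.span B = V)"
  have "\<exists>B. cfun.independent B \<and> cfun.span B = V"
    by (rule cfun.maximal_independent_subset[of V])
      (use cfun.span_minimal[OF _ \<open>cfun.subspace V\<close>] in blast)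
  then have "cfun.independent B \<and> cfun.span B = V"
    unfolding B_def by (rule someI_ex)
  then have indep: "cfun.independent B" and span: "cfun.span B = V" by auto
  have B_V: "b \<in> V" if "b \<in> B" for b
    using that span cfun.span_base by blast
  \<comment> \<open>The basis picked by \<open>SOME\<close> has to be shown finite: over an infinite
    \<open>B\<close> the sum defining the trace would be 0 by convention.\<close>
  have "B \<subseteq> cfun.span (\<delta> ` G)"
  proof
    fix b assume "b \<in> B"
    then have "b = (\<Sum>g\<in>G. cscale (b g) (\<delta> g))"
      using B_V V_algebra algebra_eq_sum_delta by blast
    also have "\<dots> \<in> cfun.span (\<delta> ` G)"
      by (intro cfun.span_sum cfun.span_scale cfun.span_base) auto
    finally show "b \<in> cfun.span (\<delta> ` G)" .
  qed
  then have finB: "finite B"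
    using cfun.independent_span_bound[of "\<delta> ` G" B] indep finite_G by blast
  define proj where "proj f = cscale (1 / a) (f \<star> c)" for f
  have proj_V: "proj f \<in> V" if "f \<in> group_algebra h" for f
  proof -
    have "proj f = cscale (1 / a) f \<star> c"
      unfolding proj_def by (rule conv_cscale_left[symmetric])
    moreover have "cscale (1 / a) f \<in> group_algebra h"
      using that by (simp add: group_algebra_def cscale_def)
    ultimately show ?thesis unfolding V_def by blast
  qed
  have proj_id: "proj v = v" if "v \<in> V" for v
    using that a by (auto simp: V_def proj_def conv_assoc square conv_cscale_right)
  let ?rep = "cfun.representation B"
  \<comment> \<open>Cyclicity of the trace by hand: expand each \<open>b\<close> in group elements,
    swap the two sums, and reassemble \<open>proj (\<delta> s \<star> \<delta> g)\<close> from its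
    coordinates in \<open>B\<close>.\<close>
  have "(\<Sum>b\<in>B. ?rep (\<delta> s \<star> b) b) = (\<Sum>b\<in>B. \<Sum>g\<in>G. b g * ?rep (proj (\<delta> s \<star> \<delta> g)) b)"
  proof (rule sum.cong[OF refl])
    fix b assume b: "b \<in> B"
    have "\<delta> s \<star> b = proj (\<delta> s \<star> b)"
      using b B_V V_closed proj_id by metis
    also have "\<dots> = (\<Sum>g\<in>G. cscale (b g) (proj (\<delta> s \<star> \<delta> g)))"
    proof
      fix t
      have "proj (\<delta> s \<star> b) t = (1 / a) * (\<Sum>g\<in>G. b g * (\<delta> s \<star> (\<delta> g \<star> c)) t)"
        unfolding proj_def cscale_def conv_assoc
        by (rule arg_cong[of _ _ "(*) (1 / a)"]) (rule conv_conv_as_sum)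
      also have "\<dots> = (\<Sum>g\<in>G. cscale (b g) (proj (\<delta> s \<star> \<delta> g)) t)"
        by (simp only: proj_def cscale_def conv_assoc sum_distrib_left mult.left_commute)
      also have "\<dots> = (\<Sum>g\<in>G. cscale (b g) (proj (\<delta> s \<star> \<delta> g))) t"
        by (simp only: sum_fun_apply)
      finally show "proj (\<delta> s \<star> b) t = (\<Sum>g\<in>G. cscale (b g) (proj (\<delta> s \<star> \<delta> g))) t" .
    qed
    finally have eq: "\<delta> s \<star> b = (\<Sum>g\<in>G. cscale (b g) (proj (\<delta> s \<star> \<delta> g)))" .
    have in_V: "proj (\<delta> s \<star> \<delta> g) \<in> cfun.span B" if "g \<in> G" for g
      unfolding span by (intro proj_V conv_in_algebra delta_in_algebra that)
    have "?rep (\<delta> s \<star> b) b = (\<Sum>g\<in>G. ?rep (cscale (b g) (proj (\<delta> s \<star> \<delta> g))) b)"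
      unfolding eq using in_V cfun.span_scale
      by (subst cfun.representation_sum[OF indep]) auto
    also have "\<dots> = (\<Sum>g\<in>G. b g * ?rep (proj (\<delta> s \<star> \<delta> g)) b)"
      by (intro sum.cong refl) (simp only: cfun.representation_scale[OF indep in_V])
    finally show "?rep (\<delta> s \<star> b) b = (\<Sum>g\<in>G. b g * ?rep (proj (\<delta> s \<star> \<delta> g)) b)" .
  qed
  also have "\<dots> = (\<Sum>g\<in>G. \<Sum>b\<in>B. b g * ?rep (proj (\<delta> s \<star> \<delta> g)) b)"
    by (rule sum.swap)
  also have "\<dots> = (\<Sum>g\<in>G. c (perm_inv g \<circ> perm_inv s \<circ> g) / a)"
  proof (rule sum.cong[OF refl])
    fix g assume g: "g \<in> G"
    let ?x = "proj (\<delta> s \<star> \<delta> g)"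
    have "?x \<in> cfun.span B"
      unfolding span by (intro proj_V conv_in_algebra delta_in_algebra g)
    then have "(\<Sum>b\<in>B. cscale (?rep ?x b) b) = ?x"
      by (intro cfun.sum_representation_eq[OF indep _ finB]) auto
    then have "?x g = (\<Sum>b\<in>B. cscale (?rep ?x b) b) g"
      by simp
    also have "\<dots> = (\<Sum>b\<in>B. cscale (?rep ?x b) b g)"
      by (simp only: sum_fun_apply)
    finally have "(\<Sum>b\<in>B. b g * ?rep ?x b) = ?x g"
      by (simp add: cscale_def mult.commute)
    also have "\<dots> = c (perm_inv (s \<circ> g) \<circ> g) / a"
      using s g by (simp only: proj_def delta_conv_delta cscale_def delta_conv G_comp) simp
    finally show "(\<Sum>b\<in>B. b g * ?rep ?x b) = c (perm_inv g \<circ> perm_inv s \<circ> g) / a"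
      by (simp only: inv_comp s g)
  qed
  finally show ?thesis
    unfolding trace_on_def V_def[symmetric] B_def[symmetric] Let_def
    by (simp only: sum_divide_distrib)
qed

end

section \<open>Young symmetrizers\<close>

definition boxes :: "nat list \<Rightarrow> (nat \<times> nat) set" where
  "boxes mu = (SIGMA r:{..<length mu}. {..<mu ! r})"

lemma card_boxes: "card (boxes mu) = sum_list mu"
  by (simp add: boxes_def sum_list_sum_nth lessThan_atLeast0)

lemma sum_list_take_Suc:
  fixes mu :: "nat list"
  shows "r < length mu \<Longrightarrow> sum_list (take (Suc r) mu) = sum_list (take r mu) + mu ! r"
  by (simp add: take_Suc_conv_app_nth)

lemma sum_list_take_mono:
  fixes mu :: "nat list"
  assumes "r \<le> r'"
  shows "sum_list (take r mu) \<le> sum_list (take r' mu)"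
proof -
  have "take r' mu = take r mu @ take (r' - r) (drop r mu)"
    using assms by (metis le_add_diff_inverse take_add)
  then show ?thesis by simp
qed

lemma box_no_less:
  assumes "r < length mu" "c < mu ! r" "r < r'"
  shows "box_no mu r c < box_no mu r' c'"
  using sum_list_take_Suc[OF assms(1)] sum_list_take_mono[of "Suc r" r' mu] assms
  by (simp add: box_no_def)

lemma box_no_bij: "bij_betw (\<lambda>(r, c). box_no mu r c) (boxes mu) {..<sum_list mu}"
proof -
  let ?f = "\<lambda>(r, c). box_no mu r c"
  have inj: "inj_on ?f (boxes mu)"
  proof (rule inj_onI, clarify)
    fix r c r' c'
    assume mem: "(r, c) \<in> boxes mu" "(r', c') \<in> boxes mu" and eq: "box_no mu r c = box_no mu r' c'"
    have "r = r'"
      using box_no_less[of r mu c r' c'] box_no_less[of r' mu c' r c] mem eq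
      by (cases r r' rule: linorder_cases) (auto simp: boxes_def)
    with eq show "r = r' \<and> c = c'" by (simp add: box_no_def)
  qed
  have "?f ` boxes mu \<subseteq> {..<sum_list mu}"
  proof clarify
    fix r c assume "(r, c) \<in> boxes mu"
    then show "box_no mu r c < sum_list mu"
      using sum_list_take_Suc[of r mu] sum_list_take_mono[of "Suc r" "length mu" mu]
      by (auto simp: boxes_def box_no_def)
  qed
  then have "?f ` boxes mu = {..<sum_list mu}"
    using card_image[OF inj] by (intro card_subset_eq) (auto simp: card_boxes)
  with inj show ?thesis by (simp add: bij_betw_def)
qed

definition box_at :: "nat list \<Rightarrow> nat \<Rightarrow> nat \<times> nat" where
  "box_at mu = inv_into (boxes mu) (\<lambda>(r, c). box_no mu r c)"

abbreviation row_of :: "nat list \<Rightarrow> nat \<Rightarrow> nat" where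
  "row_of mu x \<equiv> fst (box_at mu x)"

abbreviation col_of :: "nat list \<Rightarrow> nat \<Rightarrow> nat" where
  "col_of mu x \<equiv> snd (box_at mu x)"

lemma box_at_box_no: "(r, c) \<in> boxes mu \<Longrightarrow> box_at mu (box_no mu r c) = (r, c)"
  using bij_betw_inv_into_left[OF box_no_bij[of mu], of "(r, c)"] by (simp add: box_at_def)

lemma box_at_in_boxes: "x < sum_list mu \<Longrightarrow> (row_of mu x, col_of mu x) \<in> boxes mu"
  using bij_betw_apply[OF bij_betw_inv_into[OF box_no_bij[of mu]], of x] by (simp add: box_at_def)

lemma row_of_less: "x < sum_list mu \<Longrightarrow> row_of mu x < length mu"
  using box_at_in_boxes[of x mu] by (auto simp: boxes_def)

lemma box_no_box_at: "x < sum_list mu \<Longrightarrow> box_no mu (row_of mu x) (col_of mu x) = x"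
  using bij_betw_inv_into_right[OF box_no_bij[of mu], of x] by (simp add: box_at_def case_prod_beta)

lemma box_no_lt: "(r, c) \<in> boxes mu \<Longrightarrow> box_no mu r c < sum_list mu"
  using bij_betw_apply[OF box_no_bij[of mu], of "(r, c)"] by simp

lemma box_at_inj: "x < sum_list mu \<Longrightarrow> y < sum_list mu \<Longrightarrow> row_of mu x = row_of mu y \<Longrightarrow>
    col_of mu x = col_of mu y \<Longrightarrow> x = y"
  by (metis box_no_box_at)

text \<open>Turns the setwise description of the row and column groups into an invariance condition
  on points, for which closure under composition and inverses is easy. For the converse, an
  injective self-map of a finite fibre is onto.\<close>

lemma permutes_preserves_fibres_iff:
  assumes s: "s permutes D" and D: "finite D" and I: "f ` D \<subseteq> I"
  shows "(\<forall>i\<in>I. s ` {x \<in> D. f x = i} = {x \<in> D. f x = i}) \<longleftrightarrow> (\<forall>x\<in>D. f (s x) = f x)"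
proof
  assume "\<forall>i\<in>I. s ` {x \<in> D. f x = i} = {x \<in> D. f x = i}"
  then show "\<forall>x\<in>D. f (s x) = f x" using I by blast
next
  assume *: "\<forall>x\<in>D. f (s x) = f x"
  show "\<forall>i\<in>I. s ` {x \<in> D. f x = i} = {x \<in> D. f x = i}"
  proof
    fix i
    show "s ` {x \<in> D. f x = i} = {x \<in> D. f x = i}"
      using * D permutes_in_image[OF s] inj_on_subset[OF permutes_inj[OF s] subset_UNIV]
      by (intro endo_inj_surj) auto
  qed
qed

lemma row_group_iff:
  "s \<in> row_group mu \<longleftrightarrow> s permutes {..<sum_list mu} \<and> (\<forall>x<sum_list mu. row_of mu (s x) = row_of mu x)"
proof (cases "s permutes {..<sum_list mu}")
  case True
  have "{box_no mu r c | c. c < mu ! r} = {x \<in> {..<sum_list mu}. row_of mu x = r}" if "r < length mu" for r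
  proof (intro subset_antisym subsetI)
    fix x assume "x \<in> {box_no mu r c | c. c < mu ! r}"
    then obtain c where "x = box_no mu r c" "c < mu ! r"
      by blast
    moreover from this have "(r, c) \<in> boxes mu"
      using that by (simp add: boxes_def)
    ultimately show "x \<in> {x \<in> {..<sum_list mu}. row_of mu x = r}"
      by (simp add: box_at_box_no box_no_lt)
  next
    fix x assume "x \<in> {x \<in> {..<sum_list mu}. row_of mu x = r}"
    then have "x = box_no mu r (col_of mu x)" "col_of mu x < mu ! r"
      using box_no_box_at[of x mu] box_at_in_boxes[of x mu] by (auto simp: boxes_def)
    then show "x \<in> {box_no mu r c | c. c < mu ! r}" by blast
  qed
  then have "s \<in> row_group mu \<longleftrightarrow> (\<forall>r\<in>{..<length mu}. s ` {x \<in> {..<sum_list mu}. row_of mu x = r}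
      = {x \<in> {..<sum_list mu}. row_of mu x = r})"
    using True by (simp add: row_group_def Ball_def)
  also have "\<dots> \<longleftrightarrow> (\<forall>x\<in>{..<sum_list mu}. row_of mu (s x) = row_of mu x)"
    by (intro permutes_preserves_fibres_iff True) (auto simp: row_of_less)
  finally show ?thesis using True by (simp add: Ball_def)
qed (simp add: row_group_def)

lemma column_group_iff:
  "s \<in> column_group mu \<longleftrightarrow> s permutes {..<sum_list mu} \<and> (\<forall>x<sum_list mu. col_of mu (s x) = col_of mu x)"
proof (cases "s permutes {..<sum_list mu}")
  case True
  have "{box_no mu r c | r. r < length mu \<and> c < mu ! r} = {x \<in> {..<sum_list mu}. col_of mu x = c}" for c
  proof (intro subset_antisym subsetI)
    fix x assume "x \<in> {box_no mu r c | r. r < length mu \<and> c < mu ! r}"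
    then obtain r where "x = box_no mu r c" "(r, c) \<in> boxes mu"
      by (auto simp: boxes_def)
    then show "x \<in> {x \<in> {..<sum_list mu}. col_of mu x = c}"
      by (simp add: box_at_box_no box_no_lt)
  next
    fix x assume "x \<in> {x \<in> {..<sum_list mu}. col_of mu x = c}"
    then have "x = box_no mu (row_of mu x) c" "row_of mu x < length mu" "c < mu ! row_of mu x"
      using box_no_box_at[of x mu] box_at_in_boxes[of x mu] by (auto simp: boxes_def)
    then show "x \<in> {box_no mu r c | r. r < length mu \<and> c < mu ! r}" by blast
  qed
  then have "s \<in> column_group mu \<longleftrightarrow> (\<forall>c\<in>UNIV. s ` {x \<in> {..<sum_list mu}. col_of mu x = c}
      = {x \<in> {..<sum_list mu}. col_of mu x = c})"
    using True by (simp add: column_group_def)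
  also have "\<dots> \<longleftrightarrow> (\<forall>x\<in>{..<sum_list mu}. col_of mu (s x) = col_of mu x)"
    by (intro permutes_preserves_fibres_iff True) auto
  finally show ?thesis using True by (simp add: Ball_def)
qed (simp add: column_group_def)

text \<open>Applied with \<open>f\<close> the row of a box and weight 1, and with \<open>f\<close>
  the column of a box and the sign as weight.\<close>

lemma signed_subgroup_fibre_preserving:
  fixes f :: "nat \<Rightarrow> nat"
  assumes w: "w = (\<lambda>_. 1) \<or> w = (\<lambda>p. of_int (sign p))"
  shows "signed_subgroup h {s. s permutes {..<h} \<and> (\<forall>x<h. f (s x) = f x)} w"
proof
  fix p q
  assume p: "p \<in> {s. s permutes {..<h} \<and> (\<forall>x<h. f (s x) = f x)}"
  then have pp: "p permutes {..<h}" by simp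
  show "w p = 1 \<or> w p = -1"
    using w by (elim disjE) (simp_all add: sign_def)
  have "f (perm_inv p x) = f x" if "x < h" for x
    using p that permutes_in_image[OF permutes_inv[OF pp], of x] permutes_inverses(1)[OF pp, of x]
    by fastforce
  then show "perm_inv p \<in> {s. s permutes {..<h} \<and> (\<forall>x<h. f (s x) = f x)}"
    using permutes_inv[OF pp] by simp
  assume q: "q \<in> {s. s permutes {..<h} \<and> (\<forall>x<h. f (s x) = f x)}"
  then have qq: "q permutes {..<h}" by simp
  show "p \<circ> q \<in> {s. s permutes {..<h} \<and> (\<forall>x<h. f (s x) = f x)}"
  proof (intro CollectI conjI allI impI)
    show "p \<circ> q permutes {..<h}" using qq pp by (rule permutes_compose)
    fix x assume "x < h"
    then have "f (q x) = f x" "q x < h"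
      using q permutes_in_image[OF qq, of x] by auto
    then show "f ((p \<circ> q) x) = f x"
      using p by simp
  qed
  show "w (p \<circ> q) = w p * w q"
    using w pp qq sign_compose[of p q] permutes_imp_permutation[of "{..<h}"] by auto
qed (auto simp: permutes_id)

section \<open>Von Neumann's lemma\<close>

lemma sum_nat_set_gt_initial:
  fixes S :: "nat set"
  assumes S: "finite S" and ne: "S \<noteq> {..<card S}"
  shows "\<Sum>{..<card S} < \<Sum>S"
proof -
  let ?n = "card S"
  let ?T = "{..<?n}"
  \<comment> \<open>As many elements of \<open>S\<close> lie at or above \<open>?n\<close> as
    numbers below \<open>?n\<close> are missing from it; each exchange increases the sum.\<close>
  have card_eq: "card (S - ?T) = card (?T - S)"
    using S card_Diff_subset_Int[of S ?T] card_Diff_subset_Int[of ?T S] by (simp add: Int_commute)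
  have "?T - S \<noteq> {}"
  proof
    assume "?T - S = {}"
    with card_eq S have "S - ?T = {}" by simp
    with \<open>?T - S = {}\<close> ne show False by blast
  qed
  then have "\<Sum>(?T - S) < (\<Sum>x\<in>?T - S. ?n)"
    by (intro sum_strict_mono) auto
  also have "\<dots> = (\<Sum>x\<in>S - ?T. ?n)"
    using card_eq by simp
  also have "\<dots> \<le> \<Sum>(S - ?T)"
    by (intro sum_mono) auto
  finally have "\<Sum>(?T - S) < \<Sum>(S - ?T)" .
  moreover have "\<Sum>S = \<Sum>(S \<inter> ?T) + \<Sum>(S - ?T)"
    using S by (metis sum.Int_Diff)
  moreover have "\<Sum>?T = \<Sum>(S \<inter> ?T) + \<Sum>(?T - S)"
    by (metis Int_commute finite_lessThan sum.Int_Diff)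
  ultimately show ?thesis by simp
qed

text \<open>Row by row, the sum of the column indices is minimal exactly for an initial segment, and the
  total of these sums is the same as for \<open>mu\<close> itself.\<close>

lemma same_columns_fill_diagram:
  assumes g: "g permutes {..<sum_list mu}"
    and inj: "\<And>x y. x < sum_list mu \<Longrightarrow> y < sum_list mu \<Longrightarrow> row_of mu x = row_of mu y \<Longrightarrow>
      col_of mu (g x) = col_of mu (g y) \<Longrightarrow> x = y"
    and x: "x < sum_list mu"
  shows "(row_of mu x, col_of mu (g x)) \<in> boxes mu"
proof -
  let ?D = "{..<sum_list mu}"
  define F where "F r = {x \<in> ?D. row_of mu x = r}" for r
  define S where "S r = (\<lambda>x. col_of mu (g x)) ` F r" for r
  have injF: "inj_on (\<lambda>x. col_of mu (g x)) (F r)" for r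
    by (rule inj_onI) (auto simp: F_def intro: inj)
  have bijF: "bij_betw (col_of mu) (F r) {..<mu ! r}" if "r < length mu" for r
  proof (rule bij_betwI[where g = "box_no mu r"])
    show "col_of mu \<in> F r \<rightarrow> {..<mu ! r}"
      using box_at_in_boxes by (fastforce simp: F_def boxes_def)
    show "box_no mu r \<in> {..<mu ! r} \<rightarrow> F r"
      using that by (auto simp: F_def boxes_def box_at_box_no box_no_lt)
    show "box_no mu r (col_of mu x) = x" if "x \<in> F r" for x
      using that box_no_box_at by (auto simp: F_def)
    show "col_of mu (box_no mu r c) = c" if "c \<in> {..<mu ! r}" for c
      using that \<open>r < length mu\<close> by (simp add: box_at_box_no boxes_def)
  qed
  have cardS: "card (S r) = mu ! r" if "r < length mu" for r
    using card_image[OF injF[of r]] bij_betw_same_card[OF bijF[OF that]] by (simp add: S_def)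
  have finS: "finite (S r)" for r
    by (simp add: S_def F_def)
  have rows: "(\<Sum>r<length mu. sum f (F r)) = sum f ?D" for f :: "nat \<Rightarrow> nat"
    unfolding F_def by (intro sum.group) (auto simp: row_of_less)
  have "(\<Sum>r<length mu. \<Sum>(S r)) = (\<Sum>r<length mu. \<Sum>x\<in>F r. col_of mu (g x))"
    using injF by (simp add: S_def sum.reindex)
  also have "\<dots> = (\<Sum>x\<in>?D. col_of mu (g x))"
    by (rule rows)
  also have "\<dots> = (\<Sum>x\<in>?D. col_of mu x)"
    by (rule sum.permute[OF g, unfolded o_def, symmetric])
  also have "\<dots> = (\<Sum>r<length mu. \<Sum>x\<in>F r. col_of mu x)"
    by (rule rows[symmetric])
  also have "\<dots> = (\<Sum>r<length mu. \<Sum>{..<mu ! r})"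
    using bijF by (intro sum.cong refl sum.reindex_bij_betw) auto
  finally have total: "(\<Sum>r<length mu. \<Sum>(S r)) = (\<Sum>r<length mu. \<Sum>{..<mu ! r})" .
  have le: "\<Sum>{..<mu ! r} \<le> \<Sum>(S r)" if "r < length mu" for r
    using sum_nat_set_gt_initial[OF finS[of r]] cardS[OF that] by (cases "S r = {..<mu ! r}") auto
  have "S r = {..<mu ! r}" if r: "r < length mu" for r
  proof (rule ccontr)
    assume "S r \<noteq> {..<mu ! r}"
    then have "\<Sum>{..<mu ! r} < \<Sum>(S r)"
      using sum_nat_set_gt_initial[OF finS[of r]] cardS[OF r] by simp
    then have "(\<Sum>r<length mu. \<Sum>{..<mu ! r}) < (\<Sum>r<length mu. \<Sum>(S r))"
      using r le by (intro sum_strict_mono_ex1) auto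
    with total show False by simp
  qed
  moreover have "row_of mu x < length mu" "col_of mu (g x) \<in> S (row_of mu x)"
    using box_at_in_boxes[OF x] x by (auto simp: boxes_def S_def F_def)
  ultimately show ?thesis by (auto simp: boxes_def)
qed

text \<open>If two boxes of one row have preimages under \<open>g\<close> in one column, their
  transposition is the required \<open>r\<close>, and its conjugate is again a transposition.
  Otherwise \<open>same_columns_fill_diagram\<close> allows every box \<open>x\<close> to be moved
  within its row to the column of \<open>perm_inv g x\<close> without leaving the diagram. The
  resulting \<open>p\<close> preserves rows and \<open>p \<circ> g\<close> preserves columns, which
  gives the factorization of \<open>g\<close>.\<close>

lemma von_neumann_dichotomy:
  assumes g: "g permutes {..<sum_list mu}"
  shows "(\<exists>r\<in>row_group mu. \<exists>q\<in>column_group mu. g = r \<circ> q) \<or>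
    (\<exists>r\<in>row_group mu. perm_inv g \<circ> r \<circ> g \<in> column_group mu \<and> sign (perm_inv g \<circ> r \<circ> g) = -1)"
proof (cases "\<exists>x<sum_list mu. \<exists>y<sum_list mu. x \<noteq> y \<and> row_of mu x = row_of mu y \<and>
    col_of mu (perm_inv g x) = col_of mu (perm_inv g y)")
  case True
  then obtain x y where xy: "x < sum_list mu" "y < sum_list mu" "x \<noteq> y" "row_of mu x = row_of mu y"
    "col_of mu (perm_inv g x) = col_of mu (perm_inv g y)" by blast
  let ?r = "transpose x y" and ?q = "transpose (perm_inv g x) (perm_inv g y)"
  have g': "perm_inv g permutes {..<sum_list mu}"
    using g by (rule permutes_inv)
  have conj: "perm_inv g \<circ> ?r \<circ> g = ?q"
    by (auto simp: fun_eq_iff transpose_def permutes_inverses[OF g] permutes_inv_eq[OF g])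
  have "?r \<in> row_group mu"
    using xy by (auto simp: row_group_iff permutes_swap_id transpose_def)
  moreover have "?q \<in> column_group mu"
    using xy permutes_in_image[OF g'] by (auto simp: column_group_iff permutes_swap_id transpose_def)
  moreover have "sign ?q = -1"
    using xy(3) permutes_inj[OF g'] by (simp add: sign_swap_id inj_eq)
  ultimately show ?thesis by (metis conj)
next
  case False
  let ?D = "{..<sum_list mu}"
  have g': "perm_inv g permutes ?D"
    using g by (rule permutes_inv)
  define p where "p x = (if x < sum_list mu then box_no mu (row_of mu x) (col_of mu (perm_inv g x)) else x)" for x
  have in_boxes: "(row_of mu x, col_of mu (perm_inv g x)) \<in> boxes mu" if "x < sum_list mu" for x
    using same_columns_fill_diagram[OF g' _ that] False by blast
  have at_p: "box_at mu (p x) = (row_of mu x, col_of mu (perm_inv g x))" if "x < sum_list mu" for x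
    using that in_boxes by (simp add: p_def box_at_box_no)
  have "p permutes ?D"
  proof (rule bij_imp_permutes)
    have "inj_on p ?D"
      by (rule inj_onI) (metis False at_p fst_conv lessThan_iff snd_conv)
    moreover have "p ` ?D \<subseteq> ?D"
      using in_boxes by (auto simp: p_def box_no_lt)
    ultimately show "bij_betw p ?D ?D"
      using endo_inj_surj[of ?D p] by (simp add: bij_betw_def)
  qed (simp add: p_def)
  moreover from this have "perm_inv p permutes ?D"
    by (rule permutes_inv)
  moreover have "row_of mu (perm_inv p x) = row_of mu x" if "x < sum_list mu" for x
    using at_p[of "perm_inv p x"] that permutes_in_image[OF \<open>perm_inv p permutes ?D\<close>, of x]
      permutes_inverses(1)[OF \<open>p permutes ?D\<close>, of x] by simp
  ultimately have "perm_inv p \<in> row_group mu"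
    by (simp add: row_group_iff)
  moreover have "p \<circ> g \<in> column_group mu"
    using permutes_compose[OF g \<open>p permutes ?D\<close>] at_p permutes_in_image[OF g] permutes_inverses(2)[OF g]
    by (simp add: column_group_iff)
  moreover have "g = perm_inv p \<circ> (p \<circ> g)"
    using permutes_inverses(2)[OF \<open>p permutes ?D\<close>] by (simp add: fun_eq_iff)
  ultimately show ?thesis by blast
qed

section \<open>The Young symmetrizer and the Specht character\<close>

lemma young_pair_groups:
  "young_pair (sum_list mu) (row_group mu) (column_group mu) (\<lambda>p. of_int (sign p))"
proof -
  have row: "row_group mu = {s. s permutes {..<sum_list mu} \<and> (\<forall>x<sum_list mu. row_of mu (s x) = row_of mu x)}"
    and col: "column_group mu = {s. s permutes {..<sum_list mu} \<and> (\<forall>x<sum_list mu. col_of mu (s x) = col_of mu x)}"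
    by (auto simp: row_group_iff column_group_iff)
  interpret row: signed_subgroup "sum_list mu" "row_group mu" "\<lambda>_. 1"
    unfolding row by (rule signed_subgroup_fibre_preserving) simp
  interpret col: signed_subgroup "sum_list mu" "column_group mu" "\<lambda>p. of_int (sign p)"
    unfolding col by (rule signed_subgroup_fibre_preserving) simp
  show ?thesis
  proof
    fix g assume "g \<in> {s. s permutes {..<sum_list mu}}"
    then show "(\<exists>r\<in>row_group mu. \<exists>q\<in>column_group mu. g = r \<circ> q) \<or>
      (\<exists>r\<in>row_group mu. perm_inv g \<circ> r \<circ> g \<in> column_group mu \<and>
        of_int (sign (perm_inv g \<circ> r \<circ> g)) = (-1 :: complex))"
      using von_neumann_dichotomy[of g mu] by force
  next
    have "s x = x" if "s \<in> row_group mu" "s \<in> column_group mu" for s x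
    proof (cases "x < sum_list mu")
      case True
      have "s permutes {..<sum_list mu}" "row_of mu (s x) = row_of mu x" "col_of mu (s x) = col_of mu x"
        using that True by (simp_all only: row_group_iff column_group_iff)
      then show ?thesis
        using True permutes_in_image[of s "{..<sum_list mu}" x] box_at_inj by blast
    next
      case False
      then show ?thesis
        using that by (auto simp: row_group_iff permutes_not_in)
    qed
    then have "s = id" if "s \<in> row_group mu \<inter> column_group mu" for s
      using that by (simp add: fun_eq_iff)
    then show "row_group mu \<inter> column_group mu = {id}"
      using row.id_in col.id_in by blast
  qed
qed

interpretation young: young_pair "sum_list mu" "row_group mu" "column_group mu" "\<lambda>p. of_int (sign p)"
  for mu :: "nat list"
  by (rule young_pair_groups)

lemma young_symm_eq: "young.symm mu = young_symmetrizer mu"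
proof -
  have fin: "finite (row_group mu)" "finite (column_group mu)"
    using finite_subset[OF young.row.subset_G young.finite_G]
      finite_subset[OF young.col.subset_G young.finite_G] by auto
  have "young.row.ksum mu = (\<Sum>p\<in>row_group mu. group_elem p)"
    using fin by (intro ext) (simp add: sum_fun_apply young.row.ksum_def group_elem_def)
  moreover have "young.col.ksum mu = (\<Sum>q\<in>column_group mu. cscale (of_int (sign q)) (group_elem q))"
    using fin by (intro ext) (simp add: sum_fun_apply young.col.ksum_def group_elem_def cscale_def
        if_distrib[where f = "(*) _"] cong: if_cong)
  ultimately show ?thesis
    by (simp add: young.symm_def young_symmetrizer_def)
qed

text \<open>By the trace formula the character at \<open>perm_inv s\<close> is
  \<open>?z s / a\<close>, with \<open>?z\<close> the sum of all conjugates of the symmetrizer. As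
  \<open>?z\<close> multiplies the symmetrizer by \<open>a * a\<close>, the character multiplies it
  by \<open>a\<close>, and the witness is \<open>b = 1 / a\<close>.\<close>

lemma young_symmetrizer_via_character:
  "\<exists>b. young_symmetrizer mu = cscale b
     (convolution (sum_list mu) (\<lambda>s. specht_character mu (perm_inv s)) (young_symmetrizer mu))"
proof -
  let ?c = "young_symmetrizer mu" and ?h = "sum_list mu"
  obtain a where a: "a \<noteq> 0" "convolution ?h ?c ?c = cscale a ?c"
    using young.symm_square[of mu] by (auto simp: young_symm_eq)
  have c: "?c \<in> group_algebra ?h"
    using young.symm_in_algebra[of mu] by (simp add: young_symm_eq)
  let ?z = "\<lambda>s. \<Sum>g | g permutes {..<?h}. ?c (perm_inv g \<circ> s \<circ> g)"
  have chi: "specht_character mu (perm_inv s) = ?z s / a" if "s permutes {..<?h}" for s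
    using young.trace_left_ideal[OF c a(2,1), of "perm_inv s"] permutes_inv[OF that] that
    by (simp add: specht_character_def specht_module_def permutes_inv_inv)
  have "convolution ?h (\<lambda>s. specht_character mu (perm_inv s)) ?c
      = cscale (1 / a) (convolution ?h ?z ?c)"
    by (simp add: fun_eq_iff convolution_def cscale_def chi sum_distrib_left)
  also have "convolution ?h ?z ?c = cscale (a * a) ?c"
    using young.class_sum_conv_symm[of mu a] a(2) by (simp add: young_symm_eq)
  finally have "?c = cscale (1 / a) (convolution ?h (\<lambda>s. specht_character mu (perm_inv s)) ?c)"
    using a(1) by (simp add: cscale_def fun_eq_iff)
  then show ?thesis by blast
qed

section \<open>Permutations of a set preserving a partition into blocks\<close>

text \<open>\<open>\<beta> i\<close> enumerates the block with index \<open>i\<close>, and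
  \<open>f\<close> recovers the index from a point. Used for the rows and for the columns of a
  diagram, it matches tuples of small permutations, as they occur in
  \<open>column_perm_tuples\<close> and in products of determinants, with elements of the row and
  column groups.\<close>

locale permutation_blocks =
  fixes I :: "nat set" and m :: "nat \<Rightarrow> nat" and \<beta> :: "nat \<Rightarrow> nat \<Rightarrow> nat" and f :: "nat \<Rightarrow> nat"
  assumes finite_I: "finite I"
    and f_\<beta>: "i \<in> I \<Longrightarrow> k < m i \<Longrightarrow> f (\<beta> i k) = i"
    and inj_\<beta>: "i \<in> I \<Longrightarrow> inj_on (\<beta> i) {..<m i}"
begin

definition block :: "nat \<Rightarrow> nat set" where
  "block i = \<beta> i ` {..<m i}"

definition lift :: "nat \<Rightarrow> (nat \<Rightarrow> nat) \<Rightarrow> nat \<Rightarrow> nat" where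
  "lift i = map_permutation {..<m i} (\<beta> i)"

text \<open>The tuple is applied with \<open>J = I\<close>; a variable \<open>J\<close> serves the
  induction over blocks that computes the sign.\<close>

definition glue :: "nat set \<Rightarrow> (nat \<Rightarrow> nat \<Rightarrow> nat) \<Rightarrow> nat \<Rightarrow> nat" where
  "glue J q x = (if f x \<in> J \<and> x \<in> block (f x) then lift (f x) (q (f x)) x else x)"

lemma f_block: "i \<in> I \<Longrightarrow> x \<in> block i \<Longrightarrow> f x = i"
  by (auto simp: block_def f_\<beta>)

lemma bij_\<beta>: "i \<in> I \<Longrightarrow> bij_betw (\<beta> i) {..<m i} (block i)"
  by (simp add: bij_betw_def inj_\<beta> block_def)

lemma lift_permutes: "i \<in> I \<Longrightarrow> p permutes {..<m i} \<Longrightarrow> lift i p permutes block i"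
  unfolding lift_def by (rule map_permutation_permutes[OF bij_\<beta>])

lemma lift_\<beta>: "i \<in> I \<Longrightarrow> k < m i \<Longrightarrow> lift i p (\<beta> i k) = \<beta> i (p k)"
  unfolding lift_def using inj_\<beta> by (intro map_permutation_apply) auto

lemma glue_\<beta>: "i \<in> I \<Longrightarrow> k < m i \<Longrightarrow> glue I q (\<beta> i k) = \<beta> i (q i k)"
  by (simp add: glue_def f_\<beta> block_def lift_\<beta>)

text \<open>Disjoint supports: \<open>glue J q\<close> moves only points of the blocks in
  \<open>J\<close> and keeps them there, while \<open>lift i (q i)\<close> moves only points of
  \<open>block i\<close>.\<close>

lemma glue_insert:
  assumes "insert i J \<subseteq> I" "i \<notin> J" "\<And>j. j \<in> insert i J \<Longrightarrow> q j permutes {..<m j}"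
  shows "glue (insert i J) q = lift i (q i) \<circ> glue J q"
proof
  fix x
  have lift_i: "lift i (q i) permutes block i"
    using assms by (intro lift_permutes) auto
  show "glue (insert i J) q x = (lift i (q i) \<circ> glue J q) x"
  proof (cases "f x \<in> J \<and> x \<in> block (f x)")
    case True
    then have "lift (f x) (q (f x)) permutes block (f x)"
      using assms by (intro lift_permutes) auto
    then have "glue J q x \<in> block (f x)"
      using True permutes_in_image by (metis glue_def)
    then have "glue J q x \<notin> block i"
      using True assms(1,2) f_block by (metis insert_subset subsetD)
    then have "lift i (q i) (glue J q x) = glue J q x"
      using lift_i by (simp add: permutes_not_in)
    then show ?thesis
      using True by (simp add: glue_def)
  next
    case False
    then have J: "glue J q x = x" by (simp only: glue_def if_False)
    show ?thesis
    proof (cases "x \<in> block i")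
      case True
      then have "f x = i" using assms f_block by blast
      with True J show ?thesis by (simp add: glue_def)
    next
      case False
      then have "\<not> (f x \<in> insert i J \<and> x \<in> block (f x))"
        using \<open>\<not> (f x \<in> J \<and> x \<in> block (f x))\<close> by blast
      then have "glue (insert i J) q x = x" by (simp only: glue_def if_False)
      with False J show ?thesis using permutes_not_in[OF lift_i] by simp
    qed
  qed
qed

lemma glue_permutes_and_sign:
  assumes "J \<subseteq> I" "\<And>j. j \<in> J \<Longrightarrow> q j permutes {..<m j}"
  shows "glue J q permutes (\<Union>j\<in>J. block j) \<and> sign (glue J q) = (\<Prod>j\<in>J. sign (q j))"
  using finite_subset[OF assms(1) finite_I] assms
proof (induction J rule: finite_induct)
  case empty
  have "glue {} q = id" by (simp add: glue_def fun_eq_iff)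
  then show ?case by (simp only: permutes_id sign_id) simp
next
  case (insert i J)
  have glue: "glue (insert i J) q = lift i (q i) \<circ> glue J q"
    using insert by (intro glue_insert) auto
  have J: "glue J q permutes (\<Union>j\<in>J. block j)" "sign (glue J q) = (\<Prod>j\<in>J. sign (q j))"
    using insert by auto
  have i: "lift i (q i) permutes block i"
    using insert.prems by (intro lift_permutes) auto
  have fin: "finite (block j)" for j
    by (simp add: block_def)
  have "sign (lift i (q i)) = sign (q i)"
    unfolding lift_def using insert.prems inj_\<beta>[of i]
    by (intro sign_map_permutation) auto
  moreover have "sign (lift i (q i) \<circ> glue J q) = sign (lift i (q i)) * sign (glue J q)"
    using i J(1) fin insert.hyps
    by (intro sign_compose) (auto intro: permutes_imp_permutation[rotated])
  moreover have "lift i (q i) \<circ> glue J q permutes (\<Union>j\<in>insert i J. block j)"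
    using permutes_subset[OF i] permutes_subset[OF J(1)] by (intro permutes_compose) auto
  ultimately show ?case
    by (simp only: glue J(2) prod.insert[OF insert.hyps] simp_thms)
qed

text \<open>For surjectivity, a permutation preserving \<open>f\<close> is restricted to each block
  and transported back along \<open>\<beta> i\<close>; the tuple is cut off outside \<open>I\<close>
  so that it lies in the extensional product.\<close>

lemma glue_bij:
  "bij_betw (glue I) (\<Pi>\<^sub>E i\<in>I. {p. p permutes {..<m i}})
     {s. s permutes (\<Union>i\<in>I. block i) \<and> (\<forall>x\<in>(\<Union>i\<in>I. block i). f (s x) = f x)}"
  (is "bij_betw _ ?Q ?S")
  unfolding bij_betw_def
proof
  show "inj_on (glue I) ?Q"
  proof (rule inj_onI)
    fix q q' assume q: "q \<in> ?Q" and q': "q' \<in> ?Q" and eq: "glue I q = glue I q'"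
    show "q = q'"
    proof (rule PiE_ext[OF q q'])
      fix i assume i: "i \<in> I"
      have p: "q i permutes {..<m i}" "q' i permutes {..<m i}"
        using q q' i by auto
      show "q i = q' i"
      proof
        fix k
        show "q i k = q' i k"
        proof (cases "k < m i")
          case True
          then have "\<beta> i (q i k) = \<beta> i (q' i k)"
            using eq i glue_\<beta> by metis
          moreover have "q i k < m i" "q' i k < m i"
            using True permutes_in_image[OF p(1), of k] permutes_in_image[OF p(2), of k] by auto
          ultimately show ?thesis
            using inj_\<beta>[OF i] by (auto dest: inj_onD)
        next
          case False
          then show ?thesis using p by (simp add: permutes_not_in)
        qed
      qed
    qed
  qed
  show "glue I ` ?Q = ?S"
  proof (intro subset_antisym subsetI)
    fix s assume "s \<in> glue I ` ?Q"
    then obtain q where q: "q \<in> ?Q" and s: "s = glue I q" by blast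
    have "f (s (\<beta> i k)) = f (\<beta> i k)" if "i \<in> I" "k < m i" for i k
    proof -
      have "q i permutes {..<m i}" using q that by auto
      then have "q i k < m i" using that permutes_in_image[of "q i" "{..<m i}" k] by auto
      then show ?thesis using that by (simp add: s glue_\<beta> f_\<beta>)
    qed
    moreover have "s permutes (\<Union>i\<in>I. block i)"
      unfolding s using q glue_permutes_and_sign[of I q] by auto
    ultimately show "s \<in> ?S"
      by (simp add: block_def)
  next
    fix s assume "s \<in> ?S"
    then have s: "s permutes (\<Union>i\<in>I. block i)" "\<And>i x. i \<in> I \<Longrightarrow> x \<in> block i \<Longrightarrow> f (s x) = f x"
      by auto
    have image: "s x \<in> block i" if "i \<in> I" "x \<in> block i" for i x
    proof -
      have "s x \<in> (\<Union>i\<in>I. block i)"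
        using that permutes_in_image[OF s(1), of x] by auto
      then obtain j where j: "j \<in> I" "s x \<in> block j" by blast
      with that s(2) f_block have "j = i" by metis
      with j show ?thesis by simp
    qed
    define q where "q = (\<lambda>i\<in>I. map_permutation (block i) (inv_into {..<m i} (\<beta> i)) (restrict_id s (block i)))"
    have q: "q i permutes {..<m i}" if i: "i \<in> I" for i
    proof -
      have "inj_on s (block i)"
        using permutes_inj[OF s(1)] by (rule inj_on_subset) simp
      moreover from this have "s ` block i = block i"
        using image[OF i] by (intro endo_inj_surj) (auto simp: block_def)
      ultimately have "restrict_id s (block i) permutes block i"
        by (intro permutes_restrict_id) (simp add: bij_betw_def)
      then show ?thesis
        using i bij_betw_inv_into[OF bij_\<beta>[OF i]] by (simp add: q_def map_permutation_permutes)
    qed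
    have "glue I q x = s x" for x
    proof (cases "\<exists>i\<in>I. x \<in> block i")
      case True
      then obtain i k where ik: "i \<in> I" "k < m i" "x = \<beta> i k" by (auto simp: block_def)
      have x: "x \<in> block i" using ik by (simp add: block_def)
      have k: "inv_into {..<m i} (\<beta> i) x = k"
        using ik inj_\<beta> by simp
      have "q i (inv_into {..<m i} (\<beta> i) x) = inv_into {..<m i} (\<beta> i) (s x)"
        unfolding q_def using ik(1) x bij_betw_inv_into[OF bij_\<beta>[OF ik(1)]]
        by (simp add: map_permutation_apply bij_betw_def)
      then have "glue I q x = \<beta> i (inv_into {..<m i} (\<beta> i) (s x))"
        using ik k by (simp add: glue_\<beta>)
      also have "\<dots> = s x"
        using image[OF ik(1) x] by (simp add: block_def f_inv_into_f)
      finally show ?thesis .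
    next
      case False
      then show ?thesis
        using s(1) permutes_not_in[OF s(1), of x] by (auto simp: glue_def)
    qed
    then have "s = glue I q" by auto
    moreover have "q \<in> ?Q"
      using q by (auto simp: q_def)
    ultimately show "s \<in> glue I ` ?Q" by blast
  qed
qed

end

section \<open>Conjugate partitions\<close>

lemma less_length_filter_iff:
  fixes lam :: "nat list"
  assumes "sorted_wrt (\<ge>) lam"
  shows "c < length (filter (\<lambda>k. j < k) lam) \<longleftrightarrow> c < length lam \<and> j < lam ! c"
  using assms
proof (induction lam arbitrary: c)
  case (Cons l ls)
  show ?case
  proof (cases "j < l")
    case True
    then show ?thesis using Cons by (cases c) auto
  next
    case False
    \<comment> \<open>The head bounds the whole list, so once it fails to exceed \<open>j\<close> no
      later entry does: the entries exceeding \<open>j\<close> form an initial segment.\<close>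
    then have "filter (\<lambda>k. j < k) (l # ls) = []"
      using Cons.prems by (auto simp: filter_empty_conv)
    moreover have "(l # ls) ! c \<le> l" if "c < length (l # ls)"
      using that Cons.prems by (cases c) auto
    ultimately show ?thesis using False by fastforce
  qed
qed simp

lemma boxes_conj_partition:
  assumes "sorted_wrt (\<ge>) lam"
  shows "(r, c) \<in> boxes (conj_partition lam) \<longleftrightarrow> (c, r) \<in> boxes lam"
proof (cases lam)
  case (Cons l ls)
  have "r < length (conj_partition lam) \<longleftrightarrow> r < l"
    by (simp add: Cons)
  moreover have "conj_partition lam ! r = length (filter (\<lambda>k. r < k) lam)" if "r < l"
    using that by (simp add: Cons)
  moreover have "lam ! c \<le> l" if "c < length lam"
    using that assms by (cases c) (auto simp: Cons)
  ultimately show ?thesis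
    using less_length_filter_iff[OF assms, of c r] by (fastforce simp: boxes_def)
qed (simp add: boxes_def)

lemma sum_list_conj_partition:
  assumes "sorted_wrt (\<ge>) lam"
  shows "sum_list (conj_partition lam) = sum_list lam"
proof -
  have "bij_betw prod.swap (boxes (conj_partition lam)) (boxes lam)"
    by (rule bij_betwI[where g = prod.swap]) (auto simp: boxes_conj_partition[OF assms])
  then show ?thesis
    by (metis bij_betw_same_card card_boxes)
qed

section \<open>Constants and homogeneous components\<close>

lemma const_poly_0: "const_poly 0 = 0"
  by (simp add: const_poly_def)

lemma const_poly_1: "const_poly 1 = 1"
  by (simp add: const_poly_def)

lemma const_poly_add: "const_poly (a + b) = const_poly a + const_poly b"
  by (simp add: const_poly_def single_add)

lemma const_poly_uminus: "const_poly (- a) = - const_poly a"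
  by (simp add: const_poly_def single_uminus)

lemma const_poly_mult: "const_poly (a * b) = const_poly a * const_poly b"
  by (simp add: const_poly_def mult_single)

lemma const_poly_sum: "const_poly (\<Sum>i\<in>A. f i) = (\<Sum>i\<in>A. const_poly (f i))"
  by (induction A rule: infinite_finite_induct) (auto simp: const_poly_0 const_poly_add)

lemma const_poly_power: "const_poly (a ^ k) = const_poly a ^ k"
  by (induction k) (auto simp: const_poly_1 const_poly_mult)

lemma const_poly_minus_one_power: "const_poly ((-1) ^ k) = (-1) ^ k"
  by (simp add: const_poly_power const_poly_uminus const_poly_1)

lemma const_poly_sign: "const_poly (of_int (sign p)) = of_int (sign p)"
  by (simp add: sign_def const_poly_uminus const_poly_1)

lemma hom_component_add:
  assumes "p \<in> hom_component n d h" "q \<in> hom_component n d h"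
  shows "p + q \<in> hom_component n d h"
  using assms Poly_Mapping.keys_add[of p q] unfolding hom_component_def by blast

lemma hom_component_sum:
  "(\<And>i. i \<in> A \<Longrightarrow> f i \<in> hom_component n d h) \<Longrightarrow> (\<Sum>i\<in>A. f i) \<in> hom_component n d h"
proof (induction A rule: infinite_finite_induct)
  case (insert x F)
  then show ?case by (simp add: hom_component_add)
qed (simp_all add: hom_component_def)

lemma hom_component_const_mult:
  assumes "p \<in> hom_component n d h"
  shows "const_poly a * p \<in> hom_component n d h"
proof -
  have "Poly_Mapping.keys (const_poly a * p) \<subseteq> Poly_Mapping.keys p"
    using keys_mult[of "const_poly a" p] by (force simp: const_poly_def split: if_splits)
  with assms show ?thesis unfolding hom_component_def by blast
qed

lemma hom_component_monomial:
  assumes "\<And>x. x < h \<Longrightarrow> i x \<in> {1..n}" "\<And>x. x < h \<Longrightarrow> j x \<in> {1..d}"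
  shows "(\<Prod>x<h. letter_var (i x) (j x)) \<in> hom_component n d h"
proof -
  define e where "e k = (\<Sum>x<k. Poly_Mapping.single (i x, j x) (1 :: nat))" for k :: nat
  have "(\<Prod>x<k. letter_var (i x) (j x)) = Poly_Mapping.single (e k) 1" for k
    by (induction k) (simp_all add: e_def letter_var_def mult_single)
  moreover have "Poly_Mapping.keys (e k) \<subseteq> (\<lambda>x. (i x, j x)) ` {..<k} \<and>
      (\<Sum>y\<in>Poly_Mapping.keys (e k). Poly_Mapping.lookup (e k) y) = k" for k
  proof (induction k)
    case (Suc k)
    let ?s = "Poly_Mapping.single (i k, j k) (1 :: nat)"
    have e: "e (Suc k) = e k + ?s" by (simp add: e_def)
    let ?K = "(\<lambda>x. (i x, j x)) ` {..<Suc k}"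
    have keys: "Poly_Mapping.keys (e (Suc k)) \<subseteq> ?K"
      using Suc Poly_Mapping.keys_add[of "e k" ?s] by (auto simp: e lessThan_Suc)
    \<comment> \<open>Summing over the fixed set \<open>?K\<close> instead of the keys makes the
      total degree additive.\<close>
    have total: "(\<Sum>y\<in>Poly_Mapping.keys g. Poly_Mapping.lookup g y) = (\<Sum>y\<in>?K. Poly_Mapping.lookup g y)"
      if "Poly_Mapping.keys g \<subseteq> ?K" for g :: "(nat \<times> nat) \<Rightarrow>\<^sub>0 nat"
      using that by (intro sum.mono_neutral_left) (auto simp: in_keys_iff)
    have "(\<Sum>y\<in>?K. Poly_Mapping.lookup (e (Suc k)) y) = (\<Sum>y\<in>?K. Poly_Mapping.lookup (e k) y) + 1"
      by (simp add: e lookup_add sum.distrib lookup_single when_def)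
    moreover have "(\<Sum>y\<in>?K. Poly_Mapping.lookup (e k) y) = k"
      using Suc total[of "e k"] by (simp add: lessThan_Suc subset_insertI2)
    ultimately show ?case using total[OF keys] keys by simp
  qed (simp add: e_def)
  moreover from this have "Poly_Mapping.keys (e h) \<subseteq> {1..n} \<times> {1..d}"
    using assms by blast
  ultimately show ?thesis
    by (simp add: hom_component_def)
qed

section \<open>Bitableaux as sums over the symmetric group\<close>

lemma shape_lengths:
  assumes "shape T = lam"
  shows "length T = length lam" "r < length lam \<Longrightarrow> length (T ! r) = lam ! r"
  using assms by (auto simp: shape_def)

text \<open>The Leibniz formula in each row, multiplied out over the rows. The leading sign depends
  on the shape alone, so all summands of a symmetrized bitableau share it.\<close>

lemma bitableau_expand:
  assumes "shape S = lam" "shape T = lam"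
  shows "bitableau S T =
     (-1) ^ (\<Sum>k\<in>{1..<length lam}. lam ! k * (\<Sum>m<k. lam ! m)) * (\<Prod>r<length lam. (-1) ^ (lam ! r choose 2)) *
     (\<Sum>p\<in>(\<Pi>\<^sub>E r\<in>{..<length lam}. {p. p permutes {..<lam ! r}}).
        of_int (\<Prod>r<length lam. sign (p r)) *
        (\<Prod>r<length lam. \<Prod>c<lam ! r. letter_var (S ! r ! c) (T ! r ! p r c)))"
proof -
  have len: "length S = length lam" "length T = length lam"
    "\<And>r. r < length lam \<Longrightarrow> length (S ! r) = lam ! r \<and> length (T ! r) = lam ! r"
    using assms by (simp_all add: shape_lengths)
  have "(\<Sum>k\<in>{1..<length S}. length (S ! k) * (\<Sum>m<k. length (T ! m)))
      = (\<Sum>k\<in>{1..<length lam}. lam ! k * (\<Sum>m<k. lam ! m))"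
    using len by (intro sum.cong arg_cong2[of _ _ _ _ "(*)"]) auto
  moreover have "biproduct (S ! r) (T ! r) = (-1) ^ (lam ! r choose 2) *
      (\<Sum>p | p permutes {..<lam ! r}. of_int (sign p) * (\<Prod>c<lam ! r. letter_var (S ! r ! c) (T ! r ! p c)))"
    if r: "r < length lam" for r
  proof -
    have "p c < lam ! r" if "p permutes {0..<lam ! r}" "c < lam ! r" for p c
      using permutes_in_image[OF that(1), of c] that(2) by simp
    then show ?thesis
      using len(3)[OF r] by (auto simp: biproduct_def det_def lessThan_atLeast0 intro!: sum.cong prod.cong)
  qed
  ultimately have "bitableau S T =
     (-1) ^ (\<Sum>k\<in>{1..<length lam}. lam ! k * (\<Sum>m<k. lam ! m)) * (\<Prod>r<length lam. (-1) ^ (lam ! r choose 2)) *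
     (\<Prod>r<length lam. \<Sum>p | p permutes {..<lam ! r}. of_int (sign p) * (\<Prod>c<lam ! r. letter_var (S ! r ! c) (T ! r ! p c)))"
    by (simp add: bitableau_def len prod.distrib mult.assoc)
  also have "(\<Prod>r<length lam. \<Sum>p | p permutes {..<lam ! r}. of_int (sign p) * (\<Prod>c<lam ! r. letter_var (S ! r ! c) (T ! r ! p c)))
    = (\<Sum>p\<in>(\<Pi>\<^sub>E r\<in>{..<length lam}. {p. p permutes {..<lam ! r}}). \<Prod>r<length lam. of_int (sign (p r)) * (\<Prod>c<lam ! r. letter_var (S ! r ! c) (T ! r ! p r c)))"
    by (rule prod_sum_PiE) (auto simp: finite_permutations)
  finally show ?thesis
    by (simp add: prod.distrib)
qed

section \<open>Tableaux indexed by the boxes of the conjugate diagram\<close>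

locale conjugate_shape =
  fixes lam mu :: "nat list"
  assumes sorted: "sorted_wrt (\<ge>) lam" and mu: "mu = conj_partition lam"
begin

abbreviation h :: nat where
  "h \<equiv> sum_list mu"

lemma boxes_iff: "(c, r) \<in> boxes mu \<longleftrightarrow> (r, c) \<in> boxes lam"
  unfolding mu by (rule boxes_conj_partition[OF sorted])

text \<open>Row \<open>c\<close> of \<open>mu\<close> is column \<open>c\<close> of
  \<open>lam\<close>: these blocks carry the column permutations of the symmetrization.\<close>

sublocale row_blocks: permutation_blocks "{..<length mu}" "\<lambda>c. mu ! c" "box_no mu" "row_of mu"
proof
  show "inj_on (box_no mu c) {..<mu ! c}" for c
    by (rule inj_onI) (simp add: box_no_def)
qed (auto simp: boxes_def box_at_box_no)

text \<open>Column \<open>r\<close> of \<open>mu\<close> is row \<open>r\<close> of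
  \<open>lam\<close>: these blocks carry the permutations in the determinant of row
  \<open>r\<close>.\<close>

sublocale col_blocks: permutation_blocks "{..<length lam}" "\<lambda>r. lam ! r" "\<lambda>r c. box_no mu c r" "col_of mu"
proof
  show "inj_on (\<lambda>c. box_no mu c r) {..<lam ! r}" if r: "r \<in> {..<length lam}" for r
  proof (rule inj_onI)
    fix c c' assume "c \<in> {..<lam ! r}" "c' \<in> {..<lam ! r}" and eq: "box_no mu c r = box_no mu c' r"
    then have "(r, c) \<in> boxes lam" "(r, c') \<in> boxes lam"
      using r by (auto simp: boxes_def)
    then have "(c, r) \<in> boxes mu" "(c', r) \<in> boxes mu"
      by (simp_all only: boxes_iff)
    then show "c = c'" using eq box_at_box_no by (metis prod.inject)
  qed
  show "col_of mu (box_no mu c r) = r" if "r \<in> {..<length lam}" "c < lam ! r" for r c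
  proof -
    have "(r, c) \<in> boxes lam" using that by (simp add: boxes_def)
    then have "(c, r) \<in> boxes mu" by (simp only: boxes_iff)
    then show ?thesis by (simp add: box_at_box_no)
  qed
qed simp

lemma row_blocks_UN: "(\<Union>c\<in>{..<length mu}. row_blocks.block c) = {..<h}"
proof -
  have "(\<Union>c\<in>{..<length mu}. row_blocks.block c) = (\<lambda>(c, r). box_no mu c r) ` boxes mu"
    unfolding row_blocks.block_def boxes_def by force
  then show ?thesis using box_no_bij[of mu] by (simp add: bij_betw_def)
qed

lemma col_blocks_UN: "(\<Union>r\<in>{..<length lam}. col_blocks.block r) = {..<h}"
proof -
  have "(\<Union>r\<in>{..<length lam}. col_blocks.block r) = (\<lambda>(c, r). box_no mu c r) ` boxes mu"
  proof (intro subset_antisym subsetI)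
    fix x assume "x \<in> (\<Union>r\<in>{..<length lam}. col_blocks.block r)"
    then obtain r c where "(r, c) \<in> boxes lam" "x = box_no mu c r"
      unfolding col_blocks.block_def boxes_def by blast
    then show "x \<in> (\<lambda>(c, r). box_no mu c r) ` boxes mu"
      unfolding boxes_iff[symmetric] by force
  next
    fix x assume "x \<in> (\<lambda>(c, r). box_no mu c r) ` boxes mu"
    then obtain r c where "(r, c) \<in> boxes lam" "x = box_no mu c r"
      unfolding boxes_iff[symmetric] by force
    then show "x \<in> (\<Union>r\<in>{..<length lam}. col_blocks.block r)"
      unfolding col_blocks.block_def boxes_def by blast
  qed
  then show ?thesis using box_no_bij[of mu] by (simp add: bij_betw_def)
qed

lemma row_glue_bij:
  "bij_betw (row_blocks.glue {..<length mu}) (column_perm_tuples lam) (row_group mu)"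
proof -
  have "row_group mu = {s. s permutes {..<h} \<and> (\<forall>x\<in>{..<h}. row_of mu (s x) = row_of mu x)}"
    by (auto simp: row_group_iff)
  then show ?thesis
    using row_blocks.glue_bij unfolding row_blocks_UN column_perm_tuples_def mu[symmetric] by simp
qed

lemma col_glue_bij:
  "bij_betw (col_blocks.glue {..<length lam})
     (\<Pi>\<^sub>E r\<in>{..<length lam}. {p. p permutes {..<lam ! r}}) (column_group mu)"
proof -
  have "column_group mu = {s. s permutes {..<h} \<and> (\<forall>x\<in>{..<h}. col_of mu (s x) = col_of mu x)}"
    by (auto simp: column_group_iff)
  then show ?thesis
    using col_blocks.glue_bij unfolding col_blocks_UN by simp
qed

text \<open>The cell in row \<open>r\<close> and column \<open>c\<close> of \<open>lam\<close>
  carries the number \<open>box_no mu c r\<close>. A tableau thereby becomes a function on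
  \<open>{..<h}\<close>, where the group of \<open>mu\<close> acts.\<close>

definition entry :: "tableau \<Rightarrow> nat \<Rightarrow> nat" where
  "entry T x = T ! col_of mu x ! row_of mu x"

definition pairing :: "tableau \<Rightarrow> tableau \<Rightarrow> (nat \<Rightarrow> nat) \<Rightarrow> letter_poly" where
  "pairing S T g = (\<Prod>x<h. letter_var (entry S x) (entry T (g x)))"

lemma entry_box_no: "(r, c) \<in> boxes lam \<Longrightarrow> entry T (box_no mu c r) = T ! r ! c"
  by (simp add: entry_def box_at_box_no boxes_iff)

text \<open>The determinants move cell \<open>(r, c)\<close> to \<open>(r, p r c)\<close>; the
  permuted tableau then reads \<open>T\<close> in the same column, at row
  \<open>q (p r c) r\<close>. So the column group factor acts first, in agreement with the order of
  the factors of the Young symmetrizer.\<close>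

lemma pairing_glue:
  assumes S: "shape S = lam" and T: "shape T = lam"
    and q: "q \<in> column_perm_tuples lam"
    and p: "p \<in> (\<Pi>\<^sub>E r\<in>{..<length lam}. {p. p permutes {..<lam ! r}})"
  shows "(\<Prod>r<length lam. \<Prod>c<lam ! r. letter_var (S ! r ! c) (permute_columns q T ! r ! p r c))
    = pairing S T (row_blocks.glue {..<length mu} q \<circ> col_blocks.glue {..<length lam} p)"
proof -
  let ?g = "row_blocks.glue {..<length mu} q \<circ> col_blocks.glue {..<length lam} p"
  have "(\<Prod>r<length lam. \<Prod>c<lam ! r. letter_var (S ! r ! c) (permute_columns q T ! r ! p r c))
      = (\<Prod>(r, c)\<in>boxes lam. letter_var (S ! r ! c) (permute_columns q T ! r ! p r c))"
    by (simp add: boxes_def prod.Sigma)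
  also have "\<dots> = (\<Prod>(r, c)\<in>boxes lam. letter_var (entry S (box_no mu c r)) (entry T (?g (box_no mu c r))))"
  proof (intro prod.cong refl, clarify)
    fix r c assume rc: "(r, c) \<in> boxes lam"
    have pr: "p r permutes {..<lam ! r}"
      using p rc by (auto simp: boxes_def)
    have rc': "(r, p r c) \<in> boxes lam"
      using rc permutes_in_image[OF pr, of c] by (simp add: boxes_def)
    then have cr': "(p r c, r) \<in> boxes mu" by (simp add: boxes_iff)
    then have "q (p r c) permutes {..<mu ! (p r c)}"
      using q by (auto simp: boxes_def column_perm_tuples_def mu)
    then have "(p r c, q (p r c) r) \<in> boxes mu"
      using cr' permutes_in_image[of "q (p r c)" "{..<mu ! (p r c)}" r] by (simp add: boxes_def)
    then have box: "(q (p r c) r, p r c) \<in> boxes lam" by (simp add: boxes_iff)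
    have "?g (box_no mu c r) = box_no mu (p r c) (q (p r c) r)"
      using rc cr' by (simp add: boxes_def row_blocks.glue_\<beta> col_blocks.glue_\<beta>)
    then have "entry T (?g (box_no mu c r)) = T ! (q (p r c) r) ! (p r c)"
      using box by (simp add: entry_box_no)
    also have "\<dots> = permute_columns q T ! r ! p r c"
      using rc' T by (auto simp: permute_columns_def boxes_def shape_def)
    finally show "letter_var (S ! r ! c) (permute_columns q T ! r ! p r c)
        = letter_var (entry S (box_no mu c r)) (entry T (?g (box_no mu c r)))"
      using rc by (simp add: entry_box_no)
  qed
  also have "\<dots> = (\<Prod>(c, r)\<in>boxes mu. letter_var (entry S (box_no mu c r)) (entry T (?g (box_no mu c r))))"
    by (rule prod.reindex_bij_witness[of _ prod.swap prod.swap]) (auto simp: boxes_iff)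
  also have "\<dots> = pairing S T ?g"
    unfolding pairing_def using prod.reindex_bij_betw[OF box_no_bij[of mu], of "\<lambda>x. letter_var (entry S x) (entry T (?g x))"]
    by (simp add: case_prod_beta)
  finally show ?thesis .
qed

section \<open>The symmetrized bitableau as the action of the Young symmetrizer\<close>

lemma young_symmetrizer_sum:
  fixes F :: "(nat \<Rightarrow> nat) \<Rightarrow> letter_poly"
  shows "(\<Sum>g | g permutes {..<h}. const_poly (young_symmetrizer mu g) * F g)
    = (\<Sum>k\<in>row_group mu. \<Sum>p\<in>column_group mu. of_int (sign p) * F (k \<circ> p))"
proof -
  let ?G = "{g. g permutes {..<h}}" and ?R = "young.row.ksum mu" and ?C = "young.col.ksum mu"
  have "(\<Sum>g\<in>?G. const_poly (young_symmetrizer mu g) * F g)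
      = (\<Sum>g\<in>?G. \<Sum>s\<in>?G. const_poly (?R s * ?C (perm_inv s \<circ> g)) * F g)"
    by (simp add: young_symm_eq[symmetric] young.symm_def young.conv_apply const_poly_sum sum_distrib_right)
  also have "\<dots> = (\<Sum>s\<in>?G. \<Sum>g\<in>?G. const_poly (?R s * ?C (perm_inv s \<circ> g)) * F g)"
    by (rule sum.swap)
  also have "\<dots> = (\<Sum>s\<in>?G. \<Sum>g\<in>?G. const_poly (?R s * ?C g) * F (s \<circ> g))"
  proof (rule sum.cong[OF refl])
    fix s assume s: "s \<in> ?G"
    have "(\<Sum>g\<in>?G. const_poly (?R s * ?C (perm_inv s \<circ> g)) * F g)
        = (\<Sum>g\<in>?G. const_poly (?R s * ?C (perm_inv s \<circ> (s \<circ> g))) * F (s \<circ> g))"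
      by (rule young.sum_left[OF s, symmetric])
    then show "(\<Sum>g\<in>?G. const_poly (?R s * ?C (perm_inv s \<circ> g)) * F g)
        = (\<Sum>g\<in>?G. const_poly (?R s * ?C g) * F (s \<circ> g))"
      by (simp only: young.inv_cancel[OF s])
  qed
  also have "\<dots> = (\<Sum>s\<in>row_group mu. \<Sum>g\<in>?G. const_poly (?R s * ?C g) * F (s \<circ> g))"
    using young.row.subset_G by (intro sum.mono_neutral_right young.finite_G) (auto simp: young.row.ksum_def const_poly_0)
  also have "\<dots> = (\<Sum>k\<in>row_group mu. \<Sum>p\<in>column_group mu. const_poly (?R k * ?C p) * F (k \<circ> p))"
    using young.col.subset_G
    by (intro sum.cong refl sum.mono_neutral_right young.finite_G) (auto simp: young.col.ksum_def const_poly_0)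
  also have "\<dots> = (\<Sum>k\<in>row_group mu. \<Sum>p\<in>column_group mu. of_int (sign p) * F (k \<circ> p))"
    by (intro sum.cong refl) (simp add: young.row.ksum_def young.col.ksum_def const_poly_sign)
  finally show ?thesis .
qed

lemma right_symmetrized_expand:
  assumes S: "shape S = lam" and T: "shape T = lam"
  shows "\<exists>k. right_symmetrized S T =
    (-1) ^ k * (\<Sum>g | g permutes {..<h}. const_poly (young_symmetrizer mu g) * pairing S T g)"
proof -
  let ?P = "\<Pi>\<^sub>E r\<in>{..<length lam}. {p. p permutes {..<lam ! r}}"
  \<comment> \<open>The exponent collects the sign from arranging the rows into a product and one
    binomial sign per row.\<close>
  let ?k = "(\<Sum>k\<in>{1..<length lam}. lam ! k * (\<Sum>m<k. lam ! m)) + (\<Sum>r<length lam. lam ! r choose 2)"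
  let ?row = "row_blocks.glue {..<length mu}" and ?col = "col_blocks.glue {..<length lam}"
  have "bitableau S (permute_columns q T) =
      (-1) ^ ?k * (\<Sum>p\<in>column_group mu. of_int (sign p) * pairing S T (?row q \<circ> p))"
    if q: "q \<in> column_perm_tuples lam" for q
  proof -
    have "shape (permute_columns q T) = lam"
      using T by (auto simp: shape_def permute_columns_def intro: nth_equalityI)
    from bitableau_expand[OF S this]
    have "bitableau S (permute_columns q T) = (-1) ^ ?k *
       (\<Sum>p\<in>?P. of_int (\<Prod>r<length lam. sign (p r)) * pairing S T (?row q \<circ> ?col p))"
      by (simp add: pairing_glue[OF S T q] power_add power_sum)
    also have "(\<Sum>p\<in>?P. of_int (\<Prod>r<length lam. sign (p r)) * pairing S T (?row q \<circ> ?col p))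
        = (\<Sum>p\<in>?P. of_int (sign (?col p)) * pairing S T (?row q \<circ> ?col p))"
    proof (intro sum.cong refl)
      fix p assume "p \<in> ?P"
      then have "sign (?col p) = (\<Prod>r<length lam. sign (p r))"
        using col_blocks.glue_permutes_and_sign[of "{..<length lam}" p] by auto
      then show "of_int (\<Prod>r<length lam. sign (p r)) * pairing S T (?row q \<circ> ?col p)
          = of_int (sign (?col p)) * pairing S T (?row q \<circ> ?col p)"
        by simp
    qed
    also have "\<dots> = (\<Sum>p\<in>column_group mu. of_int (sign p) * pairing S T (?row q \<circ> p))"
      by (rule sum.reindex_bij_betw[OF col_glue_bij])
    finally show ?thesis .
  qed
  then have "right_symmetrized S T = (-1) ^ ?k *
      (\<Sum>q\<in>column_perm_tuples lam. \<Sum>p\<in>column_group mu. of_int (sign p) * pairing S T (?row q \<circ> p))"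
    by (simp add: right_symmetrized_def T sum_distrib_left)
  also have "(\<Sum>q\<in>column_perm_tuples lam. \<Sum>p\<in>column_group mu. of_int (sign p) * pairing S T (?row q \<circ> p))
      = (\<Sum>k\<in>row_group mu. \<Sum>p\<in>column_group mu. of_int (sign p) * pairing S T (k \<circ> p))"
    by (rule sum.reindex_bij_betw[OF row_glue_bij])
  finally show ?thesis
    unfolding young_symmetrizer_sum[symmetric] by blast
qed

text \<open>An immanant permutes the first word, \<open>pairing\<close> the second. In the summand
  for \<open>perm_inv s\<close>, substituting \<open>(s \<circ> g) x\<close> for the position
  \<open>k\<close> cancels the permutations of the first word and leaves \<open>s \<circ> g\<close>
  on the second. Hence the inverses in the character and in the first word.\<close>

lemma imm_pairing:
  assumes g: "g permutes {..<h}"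
  shows "imm lam (map (\<lambda>x. entry S (perm_inv g x)) [0..<h]) (map (entry T) [0..<h])
    = (-1) ^ (h choose 2) *
      (\<Sum>s | s permutes {..<h}. const_poly (chi lam (perm_inv s)) * pairing S T (s \<circ> g))"
proof -
  let ?G = "{g. g permutes {..<h}}"
  let ?u = "map (\<lambda>x. entry S (perm_inv g x)) [0..<h]" and ?v = "map (entry T) [0..<h]"
  have col: "bitableau (column (permute_list (perm_inv s) ?u)) (column ?v)
      = (-1) ^ (h choose 2) * pairing S T (s \<circ> g)" if s: "s permutes {..<h}" for s
  proof -
    have sg: "s \<circ> g permutes {..<h}" using g s by (rule permutes_compose)
    have s': "perm_inv s permutes {..<h}" using s by (rule permutes_inv)
    have "bitableau (column (permute_list (perm_inv s) ?u)) (column ?v) = (-1) ^ (h choose 2) *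
        (\<Prod>k<h. letter_var (permute_list (perm_inv s) ?u ! k) (?v ! k))"
      by (subst bitableau_column) simp_all
    also have "(\<Prod>k<h. letter_var (permute_list (perm_inv s) ?u ! k) (?v ! k))
        = (\<Prod>k<h. letter_var (entry S (perm_inv g (perm_inv s k))) (entry T k))"
      using s' permutes_in_image[OF s'] by (intro prod.cong refl) (simp add: permute_list_nth)
    also have "\<dots> = (\<Prod>x<h. letter_var (entry S (perm_inv g (perm_inv s ((s \<circ> g) x)))) (entry T ((s \<circ> g) x)))"
      using prod.permute[OF sg, of "\<lambda>k. letter_var (entry S (perm_inv g (perm_inv s k))) (entry T k)"]
      by (simp add: o_def)
    also have "\<dots> = pairing S T (s \<circ> g)"
      using permutes_inverses(2)[OF g] permutes_inverses(2)[OF s] by (simp add: pairing_def)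
    finally show ?thesis .
  qed
  have "imm lam ?u ?v = (\<Sum>s\<in>?G. const_poly (chi lam s) * bitableau (column (permute_list s ?u)) (column ?v))"
    by (simp add: imm_def)
  also have "\<dots> = (\<Sum>s\<in>?G. const_poly (chi lam (perm_inv s)) *
      bitableau (column (permute_list (perm_inv s) ?u)) (column ?v))"
    by (rule young.sum_inverse[symmetric])
  also have "\<dots> = (-1) ^ (h choose 2) * (\<Sum>s\<in>?G. const_poly (chi lam (perm_inv s)) * pairing S T (s \<circ> g))"
    unfolding sum_distrib_left by (intro sum.cong refl) (simp add: col mult.left_commute)
  finally show ?thesis .
qed

text \<open>After \<open>c\<close> is rewritten as a multiple of the character convolved with
  \<open>c\<close>, the double sum is grouped by the right factor \<open>g\<close>. The remaining
  sum over \<open>s\<close> is an immanant by \<open>imm_pairing\<close>, so its coefficient is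
  \<open>?c g\<close> up to a constant.\<close>

lemma right_symmetrized_as_immanants:
  assumes S: "shape S = lam" and T: "shape T = lam"
  shows "\<exists>a. right_symmetrized S T = (\<Sum>g | g permutes {..<h}. const_poly (a g) *
    imm lam (map (\<lambda>x. entry S (perm_inv g x)) [0..<h]) (map (entry T) [0..<h]))"
proof -
  let ?G = "{g. g permutes {..<h}}"
  let ?c = "young_symmetrizer mu" and ?chi = "\<lambda>s. chi lam (perm_inv s)"
  let ?i = "\<lambda>g. imm lam (map (\<lambda>x. entry S (perm_inv g x)) [0..<h]) (map (entry T) [0..<h])"
  obtain b where b: "?c = cscale b (convolution h ?chi ?c)"
    using young_symmetrizer_via_character[of mu] by (auto simp: chi_def mu)
  obtain k where k: "right_symmetrized S T = (-1) ^ k * (\<Sum>g\<in>?G. const_poly (?c g) * pairing S T g)"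
    using right_symmetrized_expand[OF S T] by blast
  let ?e = "(-1) ^ (h choose 2) :: complex"
  have "(\<Sum>g\<in>?G. const_poly ((convolution h ?chi ?c) g) * pairing S T g)
      = (\<Sum>g\<in>?G. \<Sum>s\<in>?G. const_poly (?chi s * ?c (perm_inv s \<circ> g)) * pairing S T g)"
    by (simp add: young.conv_apply const_poly_sum sum_distrib_right)
  also have "\<dots> = (\<Sum>s\<in>?G. \<Sum>g\<in>?G. const_poly (?chi s * ?c (perm_inv s \<circ> g)) * pairing S T g)"
    by (rule sum.swap)
  also have "\<dots> = (\<Sum>s\<in>?G. \<Sum>g\<in>?G. const_poly (?chi s * ?c g) * pairing S T (s \<circ> g))"
  proof (rule sum.cong[OF refl])
    fix s assume s: "s \<in> ?G"
    have "(\<Sum>g\<in>?G. const_poly (?chi s * ?c (perm_inv s \<circ> g)) * pairing S T g)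
        = (\<Sum>g\<in>?G. const_poly (?chi s * ?c (perm_inv s \<circ> (s \<circ> g))) * pairing S T (s \<circ> g))"
      by (rule young.sum_left[OF s, symmetric])
    then show "(\<Sum>g\<in>?G. const_poly (?chi s * ?c (perm_inv s \<circ> g)) * pairing S T g)
        = (\<Sum>g\<in>?G. const_poly (?chi s * ?c g) * pairing S T (s \<circ> g))"
      by (simp only: young.inv_cancel[OF s])
  qed
  also have "\<dots> = (\<Sum>g\<in>?G. \<Sum>s\<in>?G. const_poly (?chi s * ?c g) * pairing S T (s \<circ> g))"
    by (rule sum.swap)
  also have "\<dots> = (\<Sum>g\<in>?G. const_poly (?e * ?c g) * ?i g)"
  proof (rule sum.cong[OF refl])
    fix g assume "g \<in> ?G"
    then have i: "?i g = const_poly ?e * (\<Sum>s\<in>?G. const_poly (?chi s) * pairing S T (s \<circ> g))"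
      by (simp add: imm_pairing const_poly_minus_one_power)
    have "(\<Sum>s\<in>?G. const_poly (?chi s * ?c g) * pairing S T (s \<circ> g))
        = const_poly (?c g) * (\<Sum>s\<in>?G. const_poly (?chi s) * pairing S T (s \<circ> g))"
      by (simp add: const_poly_mult sum_distrib_left mult_ac)
    \<comment> \<open>Inserts \<open>?e * ?e = 1\<close>; one of the two factors is the sign carried
      by the immanant.\<close>
    also have "\<dots> = const_poly (?e * ?c g * ?e) * (\<Sum>s\<in>?G. const_poly (?chi s) * pairing S T (s \<circ> g))"
      by (simp add: power_mult_distrib[symmetric] mult.commute mult.left_commute)
    also have "\<dots> = const_poly (?e * ?c g) * ?i g"
      by (simp only: i const_poly_mult mult.assoc)
    finally show "(\<Sum>s\<in>?G. const_poly (?chi s * ?c g) * pairing S T (s \<circ> g)) = const_poly (?e * ?c g) * ?i g" .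
  qed
  finally have *: "(\<Sum>g\<in>?G. const_poly ((convolution h ?chi ?c) g) * pairing S T g) = (\<Sum>g\<in>?G. const_poly (?e * ?c g) * ?i g)" .
  have "right_symmetrized S T = const_poly ((-1) ^ k) *
      (\<Sum>g\<in>?G. const_poly (cscale b (convolution h ?chi ?c) g) * pairing S T g)"
    by (simp only: k b[symmetric] const_poly_minus_one_power)
  also have "\<dots> = const_poly ((-1) ^ k * b) * (\<Sum>g\<in>?G. const_poly ((convolution h ?chi ?c) g) * pairing S T g)"
    by (simp add: cscale_def const_poly_mult sum_distrib_left mult.assoc)
  also have "\<dots> = (\<Sum>g\<in>?G. const_poly ((-1) ^ k * b * (?e * ?c g)) * ?i g)"
    unfolding * by (simp add: const_poly_mult sum_distrib_left mult.assoc)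
  finally show ?thesis
    by (intro exI[of _ "\<lambda>g. (-1) ^ k * b * (?e * ?c g)"])
qed

lemma entry_in_alphabet:
  assumes T: "is_tableau lam A T" and x: "x < h"
  shows "entry T x \<in> A"
proof -
  have "(col_of mu x, row_of mu x) \<in> boxes lam"
    using box_at_in_boxes[OF x] boxes_iff by blast
  then have "col_of mu x < length T" "row_of mu x < length (T ! col_of mu x)"
    using T by (auto simp: boxes_def is_tableau_def shape_def)
  then have "T ! col_of mu x \<in> set T" "entry T x \<in> set (T ! col_of mu x)"
    by (simp_all add: entry_def)
  moreover have "\<forall>w\<in>set T. set w \<subseteq> A"
    using T by (simp add: is_tableau_def)
  ultimately show ?thesis
    by blast
qed

end

section \<open>Collecting the coefficients word by word\<close>

theorem proposition2p15:
  fixes n d h :: nat and lam :: "nat list" and U V :: tableau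
  assumes "n \<ge> 1" and "d \<ge> 1" and "h \<ge> 1"
    and "is_partition lam h"
    and "is_tableau lam {1..n} U"
    and "is_tableau lam {1..d} V"
  shows "right_symmetrized U V \<in> hom_component n d h \<and>
    (\<exists>a :: nat list \<Rightarrow> nat list \<Rightarrow> complex.
       right_symmetrized U V =
         (\<Sum>u\<in>words {1..n} h. \<Sum>v\<in>words {1..d} h. const_poly (a u v) * imm lam u v))"
proof
  interpret conjugate_shape lam "conj_partition lam"
    by unfold_locales (use assms(4) in \<open>auto simp: is_partition_def\<close>)
  have h: "sum_list (conj_partition lam) = h"
    using assms(4) sum_list_conj_partition[OF sorted] by (simp add: is_partition_def)
  have shapes: "shape U = lam" "shape V = lam"
    using assms(5,6) by (auto simp: is_tableau_def)
  have U: "entry U x \<in> {1..n}" and V: "entry V x \<in> {1..d}" if "x < h" for x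
    using that h entry_in_alphabet[OF assms(5)] entry_in_alphabet[OF assms(6)] by blast+
  have "pairing U V g \<in> hom_component n d h" if "g permutes {..<h}" for g
    unfolding pairing_def h using U V permutes_in_image[OF that]
    by (intro hom_component_monomial) blast+
  moreover obtain k where "right_symmetrized U V = const_poly ((-1) ^ k) *
      (\<Sum>g | g permutes {..<h}. const_poly (young_symmetrizer (conj_partition lam) g) * pairing U V g)"
    using right_symmetrized_expand[OF shapes] unfolding h const_poly_minus_one_power by blast
  ultimately show "right_symmetrized U V \<in> hom_component n d h"
    by (auto intro!: hom_component_const_mult hom_component_sum)
  let ?u = "\<lambda>g. map (\<lambda>x. entry U (perm_inv g x)) [0..<h]" and ?v = "map (entry V) [0..<h]"
  obtain c where c: "right_symmetrized U V =
      (\<Sum>g | g permutes {..<h}. const_poly (c g) * imm lam (?u g) ?v)"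
    using right_symmetrized_as_immanants[OF shapes] unfolding h by blast
  have u_word: "?u g \<in> words {1..n} h" if g: "g permutes {..<h}" for g
    using U permutes_in_image[OF permutes_inv[OF g]] by (auto simp: words_def)
  have v_word: "?v \<in> words {1..d} h"
    using V by (auto simp: words_def)
  have finite_words: "finite (words A h)" if "finite A" for A
    using finite_lists_length_eq[OF that, of h] by (simp add: words_def conj_commute)
  \<comment> \<open>If \<open>U\<close> has repeated entries, different \<open>g\<close> can give
    the same first word, so their coefficients are added up. The second word is always
    \<open>?v\<close>, and \<open>a\<close> vanishes at every other one.\<close>
  define a where "a u v = (\<Sum>g | g permutes {..<h} \<and> ?u g = u. if v = ?v then c g else 0)" for u v
  have "(\<Sum>u\<in>words {1..n} h. \<Sum>v\<in>words {1..d} h. const_poly (a u v) * imm lam u v)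
      = (\<Sum>u\<in>words {1..n} h. const_poly (\<Sum>g | g permutes {..<h} \<and> ?u g = u. c g) * imm lam u ?v)"
  proof (rule sum.cong[OF refl])
    fix u
    have "(\<Sum>v\<in>words {1..d} h. const_poly (a u v) * imm lam u v)
        = (\<Sum>v\<in>words {1..d} h. if v = ?v then const_poly (\<Sum>g | g permutes {..<h} \<and> ?u g = u. c g) * imm lam u v else 0)"
      by (intro sum.cong refl) (simp add: a_def const_poly_0)
    then show "(\<Sum>v\<in>words {1..d} h. const_poly (a u v) * imm lam u v)
        = const_poly (\<Sum>g | g permutes {..<h} \<and> ?u g = u. c g) * imm lam u ?v"
      using v_word finite_words by simp
  qed
  also have "\<dots> = (\<Sum>u\<in>words {1..n} h. \<Sum>g\<in>{g \<in> {g. g permutes {..<h}}. ?u g = u}. const_poly (c g) * imm lam (?u g) ?v)"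
    by (intro sum.cong refl) (simp add: const_poly_sum sum_distrib_right)
  also have "\<dots> = (\<Sum>g | g permutes {..<h}. const_poly (c g) * imm lam (?u g) ?v)"
    using u_word by (intro sum.group finite_words finite_permutations subsetI) blast+
  finally show "\<exists>a. right_symmetrized U V =
      (\<Sum>u\<in>words {1..n} h. \<Sum>v\<in>words {1..d} h. const_poly (a u v) * imm lam u v)"
    unfolding c by (intro exI[of _ a]) (rule sym)
qed

end
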